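(* Let $K$ be a field of characteristic zero and let $0\to M_\infty(K)\to E\to K[x,x^{-1}]\to 0$ be a faithful extension of the Laurent polynomial algebra $K[x,x^{-1}]$ by $M_\infty(K)$, with invariant $\psi: K[x,x^{-1}]\to Q(K)$. Then the extension $E$ is trivial if and only if $\operatorname{Ind}(\psi(x))=0$.
   Context: $\mathbb{Z}^+$ denotes the positive integers. All $K$-algebras (except $M_\infty(K)$) are unital, and homomorphisms between unital algebras are unital. $\mathrm{B}(K)$ is the $K$-algebra of $\mathbb{Z}^+\times\mathbb{Z}^+$ matrices over $K$ with only finitely many nonzero entries in each row and each column. $M_\infty(K)$ is the ideal of $\mathrm{B}(K)$ of matrices with only finitely many nonzero entries; $e_{ij}$ are its standard matrix units. $Q(K)=\mathrm{B}(K)/M_\infty(K)$, with quotient map $\pi:\mathrm{B}(K)\to Q(K)$. An extension of an algebra $A$ by $M_\infty(K)$ is a short exact sequence of algebras $0\to M_\infty(K)\xrightarrow{i}E\xrightarrow{p}A\to 0$; identify $M_\infty(K)$ with the ideal $i(M_\infty(K))$ of $E$. A two-sided ideal $I$ of $E$ is faithful if $aI=\{0\}$ implies $a=0$ and $Ib=\{0\}$ implies $b=0$; the extension is faithful if $M_\infty(K)$ is a faithful ideal of $E$. There is a unique homomorphism $\phi:E\to \mathrm{B}(K)$ restricting to the identity inclusion on $M_\infty(K)$ (the $(r,s)$ entry of $\phi(a)$ is the scalar $a_{rs}$ with $e_{rr}ae_{ss}=a_{rs}e_{rs}$). The invariant of the extension is the induced homomorphism $\psi:A\to Q(K)$ given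 by $\psi(p(a))=\pi(\phi(a))$ for $a\in E$. A faithful extension is trivial if there is an algebra homomorphism $\rho:A\to E$ with $p\circ\rho=\mathrm{id}_A$. A matrix $T\in \mathrm{B}(K)$ is Fredholm if $\pi(T)$ is invertible in $Q(K)$. Let $V$ be the $K$-vector space with basis $\{b_i: i\in\mathbb{Z}^+\}$ (columns with finitely many nonzero entries); $\ker(T)$ and $\operatorname{coker}(T)$ are the kernel and cokernel of $V\to V$, $v\mapsto Tv$. For Fredholm $T$ these are finite-dimensional, and $\operatorname{Ind}(T)=\dim\ker(T)-\dim\operatorname{coker}(T)$. The index is unchanged by adding an element of $M_\infty(K)$, so for an invertible element $q\in Q(K)$ one sets $\operatorname{Ind}(q)=\operatorname{Ind}(T)$ for any $T\in\mathrm{B}(K)$ with $\pi(T)=q$. The element $\psi(x)$ is invertible in $Q(K)$. *)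

theory Defs
  imports "HOL-Library.Poly_Mapping" "HOL-Algebra.AbelCoset" "Jordan_Normal_Form.VS_Connect"
begin

section \<open>Unital algebras over a field\<close>

locale unital_algebra = vector_space scale
  for scale :: "'k::field \<Rightarrow> 'a::ring_1 \<Rightarrow> 'a" +
  assumes scale_mult_left: "scale c a * b = scale c (a * b)"
    and scale_mult_right: "a * scale c b = scale c (a * b)"

definition unital_algebra_hom ::
  "('k::field \<Rightarrow> 'a::ring_1 \<Rightarrow> 'a) \<Rightarrow> ('k \<Rightarrow> 'b::ring_1 \<Rightarrow> 'b) \<Rightarrow> ('a \<Rightarrow> 'b) \<Rightarrow> bool" where
  "unital_algebra_hom sA sB f \<longleftrightarrow>
     Vector_Spaces.linear sA sB f \<and> (\<forall>a b. f (a * b) = f a * f b) \<and> f 1 = 1"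


section \<open>The algebra of row- and column-finite matrices\<close>

text \<open>Rows and columns are numbered from 0, i.e. the index \<^term>\<open>n\<close> stands for the
  positive integer \<^term>\<open>n + 1\<close>.\<close>

typedef (overloaded) 'k bmat =
  "{f :: nat \<Rightarrow> nat \<Rightarrow> 'k::zero. (\<forall>r. finite {s. f r s \<noteq> 0}) \<and> (\<forall>s. finite {r. f r s \<noteq> 0})}"
  morphisms entry Abs_bmat
  by (rule exI[of _ "\<lambda>_ _. 0"]) simp

setup_lifting type_definition_bmat

lemma bmat_eqI: "(\<And>r s. entry A r s = entry B r s) \<Longrightarrow> A = B"
  by (auto simp: entry_inject[symmetric] fun_eq_iff)

lemma finite_row: "finite {s. entry A r s \<noteq> 0}"
  and finite_col: "finite {r. entry A r s \<noteq> 0}"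
  using entry[of A] by auto

lemma finite_prod_row:
  fixes A B :: "nat \<Rightarrow> nat \<Rightarrow> 'k::semiring_0"
  assumes "finite {k. A r k \<noteq> 0}" and "\<And>k. finite {s. B k s \<noteq> 0}"
  shows "finite {s. (\<Sum>k | A r k \<noteq> 0. A r k * B k s) \<noteq> 0}"
proof (rule finite_subset)
  show "{s. (\<Sum>k | A r k \<noteq> 0. A r k * B k s) \<noteq> 0} \<subseteq> (\<Union>k\<in>{k. A r k \<noteq> 0}. {s. B k s \<noteq> 0})"
    by (auto elim!: sum.not_neutral_contains_not_neutral)
  show "finite (\<Union>k\<in>{k. A r k \<noteq> 0}. {s. B k s \<noteq> 0})"
    using assms by blast
qed

lemma finite_prod_col:
  fixes A B :: "nat \<Rightarrow> nat \<Rightarrow> 'k::semiring_0"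
  assumes "finite {k. B k s \<noteq> 0}" and "\<And>k. finite {r. A r k \<noteq> 0}"
  shows "finite {r. (\<Sum>k | A r k \<noteq> 0. A r k * B k s) \<noteq> 0}"
proof (rule finite_subset)
  show "{r. (\<Sum>k | A r k \<noteq> 0. A r k * B k s) \<noteq> 0} \<subseteq> (\<Union>k\<in>{k. B k s \<noteq> 0}. {r. A r k \<noteq> 0})"
  proof
    fix r assume "r \<in> {r. (\<Sum>k | A r k \<noteq> 0. A r k * B k s) \<noteq> 0}"
    then obtain k where "A r k \<noteq> 0" and "A r k * B k s \<noteq> 0"
      by (auto elim!: sum.not_neutral_contains_not_neutral)
    then have "A r k \<noteq> 0" and "B k s \<noteq> 0" by auto
    then show "r \<in> (\<Union>k\<in>{k. B k s \<noteq> 0}. {r. A r k \<noteq> 0})" by blast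
  qed
  show "finite (\<Union>k\<in>{k. B k s \<noteq> 0}. {r. A r k \<noteq> 0})"
    using assms by blast
qed

instantiation bmat :: (field) ring_1
begin

lift_definition zero_bmat :: "'a bmat" is "\<lambda>_ _. 0" by simp

lift_definition one_bmat :: "'a bmat" is "\<lambda>r s. if r = s then 1 else 0" by simp

lift_definition plus_bmat :: "'a bmat \<Rightarrow> 'a bmat \<Rightarrow> 'a bmat" is "\<lambda>f g r s. f r s + g r s"
proof -
  fix f g :: "nat \<Rightarrow> nat \<Rightarrow> 'a"
  assume "(\<forall>r. finite {s. f r s \<noteq> 0}) \<and> (\<forall>s. finite {r. f r s \<noteq> 0})"
    and "(\<forall>r. finite {s. g r s \<noteq> 0}) \<and> (\<forall>s. finite {r. g r s \<noteq> 0})"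
  moreover have "{s. f r s + g r s \<noteq> 0} \<subseteq> {s. f r s \<noteq> 0} \<union> {s. g r s \<noteq> 0}" for r by auto
  moreover have "{r. f r s + g r s \<noteq> 0} \<subseteq> {r. f r s \<noteq> 0} \<union> {r. g r s \<noteq> 0}" for s by auto
  ultimately show "(\<forall>r. finite {s. f r s + g r s \<noteq> 0}) \<and> (\<forall>s. finite {r. f r s + g r s \<noteq> 0})"
    by (meson finite_UnI finite_subset)
qed

lift_definition uminus_bmat :: "'a bmat \<Rightarrow> 'a bmat" is "\<lambda>f r s. - f r s" by simp

definition minus_bmat :: "'a bmat \<Rightarrow> 'a bmat \<Rightarrow> 'a bmat" where
  "minus_bmat A B = A + (- B)"

lift_definition times_bmat :: "'a bmat \<Rightarrow> 'a bmat \<Rightarrow> 'a bmat"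
  is "\<lambda>f g r s. \<Sum>k | f r k \<noteq> 0. f r k * g k s"
  by (intro conjI allI finite_prod_row finite_prod_col) auto

lemma entry_times_superset:
  assumes "finite X" and "{k. entry A r k \<noteq> 0} \<subseteq> X"
  shows "entry (A * B) r s = (\<Sum>k\<in>X. entry A r k * entry B k s)"
proof -
  have "entry (A * B) r s = (\<Sum>k | entry A r k \<noteq> 0. entry A r k * entry B k s)"
    by transfer simp
  also have "\<dots> = (\<Sum>k\<in>X. entry A r k * entry B k s)"
    by (rule sum.mono_neutral_left[OF assms]) auto
  finally show ?thesis .
qed

lemma bmat_mult_assoc: "(A * B) * C = A * (B * (C :: 'a bmat))"
proof (rule bmat_eqI)
  fix r s
  define X where "X = {k. entry A r k \<noteq> 0}"
  define Y where "Y = (\<Union>k\<in>X. {l. entry B k l \<noteq> 0})"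
  have X: "finite X" and Y: "finite Y" unfolding Y_def X_def using finite_row by blast+
  have AB: "entry (A * B) r l = (\<Sum>k\<in>X. entry A r k * entry B k l)" for l
    by (rule entry_times_superset[OF X]) (simp add: X_def)
  have "{l. entry (A * B) r l \<noteq> 0} \<subseteq> Y"
    unfolding Y_def AB by (auto elim!: sum.not_neutral_contains_not_neutral)
  then have "entry ((A * B) * C) r s = (\<Sum>l\<in>Y. (\<Sum>k\<in>X. entry A r k * entry B k l) * entry C l s)"
    using entry_times_superset[OF Y, of "A * B" r C s] by (simp add: AB)
  also have "\<dots> = (\<Sum>l\<in>Y. \<Sum>k\<in>X. entry A r k * (entry B k l * entry C l s))"
    by (simp add: sum_distrib_right mult.assoc)
  also have "\<dots> = (\<Sum>k\<in>X. \<Sum>l\<in>Y. entry A r k * (entry B k l * entry C l s))"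
    by (rule sum.swap)
  also have "\<dots> = (\<Sum>k\<in>X. entry A r k * entry (B * C) k s)"
  proof (rule sum.cong[OF refl])
    fix k assume "k \<in> X"
    then have "{l. entry B k l \<noteq> 0} \<subseteq> Y" by (auto simp: Y_def)
    then have "entry (B * C) k s = (\<Sum>l\<in>Y. entry B k l * entry C l s)"
      by (rule entry_times_superset[OF Y])
    then show "(\<Sum>l\<in>Y. entry A r k * (entry B k l * entry C l s)) = entry A r k * entry (B * C) k s"
      by (simp add: sum_distrib_left)
  qed
  also have "\<dots> = entry (A * (B * C)) r s"
    by (rule entry_times_superset[OF X, symmetric]) (simp add: X_def)
  finally show "entry ((A * B) * C) r s = entry (A * (B * C)) r s" .
qed

lemma bmat_distrib_right: "(A + B) * C = A * C + B * (C :: 'a bmat)"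
proof (rule bmat_eqI)
  fix r s
  define X where "X = {k. entry A r k \<noteq> 0} \<union> {k. entry B r k \<noteq> 0}"
  have X: "finite X" unfolding X_def using finite_row by blast
  have plus: "entry (F + G) a b = entry F a b + entry G a b" for F G :: "'a bmat" and a b
    by transfer simp
  have "{k. entry (A + B) r k \<noteq> 0} \<subseteq> X" by (auto simp: X_def plus)
  moreover have "{k. entry A r k \<noteq> 0} \<subseteq> X" "{k. entry B r k \<noteq> 0} \<subseteq> X" by (auto simp: X_def)
  ultimately show "entry ((A + B) * C) r s = entry (A * C + B * C) r s"
    by (simp add: entry_times_superset[OF X] plus sum.distrib distrib_right)
qed

instance
proof
  fix A B C :: "'a bmat"
  show "A + B + C = A + (B + C)" by transfer (simp add: add.assoc)
  show "A + B = B + A" by transfer (simp add: add.commute)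
  show "0 + A = A" by transfer simp
  show "- A + A = 0" by transfer simp
  show "A - B = A + - B" by (rule minus_bmat_def)
  show "A * B * C = A * (B * C)" by (rule bmat_mult_assoc)
  show "1 * A = A" by transfer (simp add: fun_eq_iff)
  show "A * 1 = A"
    by transfer (auto simp: fun_eq_iff if_distrib sum.If_cases cong: if_cong)
  show "(A + B) * C = A * C + B * C" by (rule bmat_distrib_right)
  show "A * (B + C) = A * B + A * C" by transfer (simp add: sum.distrib distrib_left)
  show "(0 :: 'a bmat) \<noteq> 1" by transfer (auto simp: fun_eq_iff)
qed

end

lift_definition bmat_scale :: "'k::field \<Rightarrow> 'k bmat \<Rightarrow> 'k bmat" is "\<lambda>c f r s. c * f r s"
  by simp

lemma entry_zero: "entry (0 :: 'k::field bmat) r s = 0"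
  and entry_plus: "entry (A + B) r s = entry A r s + entry (B :: 'k bmat) r s"
  and entry_uminus: "entry (- A) r s = - entry (A :: 'k bmat) r s"
  and entry_minus: "entry (A - B) r s = entry A r s - entry (B :: 'k bmat) r s"
  and entry_scale: "entry (bmat_scale c A) r s = c * entry (A :: 'k bmat) r s"
  unfolding minus_bmat_def by (transfer; simp)+

lemma unital_algebra_bmat: "unital_algebra (bmat_scale :: 'k::field \<Rightarrow> _)"
proof
  fix c d :: 'k and A B :: "'k bmat"
  show "bmat_scale c (A + B) = bmat_scale c A + bmat_scale c B"
    by transfer (simp add: distrib_left)
  show "bmat_scale (c + d) A = bmat_scale c A + bmat_scale d A"
    by transfer (simp add: distrib_right)
  show "bmat_scale c (bmat_scale d A) = bmat_scale (c * d) A"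
    by transfer (simp add: mult.assoc)
  show "bmat_scale 1 A = A" by transfer simp
  note times = entry_times_superset[OF finite_row[of A]]
  show "bmat_scale c A * B = bmat_scale c (A * B)"
  proof (rule bmat_eqI)
    fix r s
    have "entry (bmat_scale c A * B) r s
        = (\<Sum>k | entry A r k \<noteq> 0. entry (bmat_scale c A) r k * entry B k s)"
      by (rule entry_times_superset[OF finite_row]) (auto simp: entry_scale)
    also have "\<dots> = entry (bmat_scale c (A * B)) r s"
      by (simp add: entry_scale times[OF order_refl] sum_distrib_left mult.assoc)
    finally show "entry (bmat_scale c A * B) r s = entry (bmat_scale c (A * B)) r s" .
  qed
  show "A * bmat_scale c B = bmat_scale c (A * B)"
    by (rule bmat_eqI)
      (simp add: entry_scale times[OF order_refl] sum_distrib_left mult.left_commute)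
qed


section \<open>The ideal of finite matrices and the quotient algebra\<close>

definition Minf :: "'k::field bmat set" where
  "Minf = {A. finite {(r, s). entry A r s \<noteq> 0}}"

lemma Minf_zero: "0 \<in> Minf"
  by (simp add: Minf_def entry_zero)

lemma Minf_add:
  assumes "A \<in> Minf" and "B \<in> Minf"
  shows "A + B \<in> Minf"
proof -
  have "{(r, s). entry (A + B) r s \<noteq> 0} \<subseteq> {(r, s). entry A r s \<noteq> 0} \<union> {(r, s). entry B r s \<noteq> 0}"
    by (auto simp: entry_plus)
  then show ?thesis using assms unfolding Minf_def mem_Collect_eq by (meson finite_UnI finite_subset)
qed

lemma Minf_scale: "A \<in> Minf \<Longrightarrow> bmat_scale c A \<in> Minf"
  unfolding Minf_def mem_Collect_eq by (erule rev_finite_subset) (auto simp: entry_scale)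

lemma Minf_uminus: "A \<in> Minf \<Longrightarrow> - A \<in> Minf"
  by (simp add: Minf_def entry_uminus)

lemma Minf_mult_right:
  assumes "A \<in> Minf"
  shows "A * B \<in> Minf"
proof -
  let ?S = "{(r, s). entry A r s \<noteq> 0}"
  have "{(r, s). entry (A * B) r s \<noteq> 0} \<subseteq> (\<Union>(r, k)\<in>?S. {r} \<times> {s. entry B k s \<noteq> 0})"
  proof clarify
    fix r s assume "entry (A * B) r s \<noteq> 0"
    then have "(\<Sum>k | entry A r k \<noteq> 0. entry A r k * entry B k s) \<noteq> 0" by transfer simp
    then obtain k where "entry A r k \<noteq> 0" "entry B k s \<noteq> 0"
      by (auto elim!: sum.not_neutral_contains_not_neutral)
    then show "(r, s) \<in> (\<Union>(r, k)\<in>?S. {r} \<times> {s. entry B k s \<noteq> 0})" by auto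
  qed
  moreover have "finite (\<Union>(r, k)\<in>?S. {r} \<times> {s. entry B k s \<noteq> 0})"
    using assms finite_row by (auto simp: Minf_def)
  ultimately show ?thesis unfolding Minf_def mem_Collect_eq by (rule finite_subset)
qed

lemma Minf_mult_left:
  assumes "B \<in> Minf"
  shows "A * B \<in> Minf"
proof -
  let ?S = "{(k, s). entry B k s \<noteq> 0}"
  have "{(r, s). entry (A * B) r s \<noteq> 0} \<subseteq> (\<Union>(k, s)\<in>?S. {r. entry A r k \<noteq> 0} \<times> {s})"
  proof clarify
    fix r s assume "entry (A * B) r s \<noteq> 0"
    then have "(\<Sum>k | entry A r k \<noteq> 0. entry A r k * entry B k s) \<noteq> 0" by transfer simp
    then obtain k where "entry A r k \<noteq> 0" "entry B k s \<noteq> 0"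
      by (auto elim!: sum.not_neutral_contains_not_neutral)
    then show "(r, s) \<in> (\<Union>(k, s)\<in>?S. {r. entry A r k \<noteq> 0} \<times> {s})" by auto
  qed
  moreover have "finite (\<Union>(k, s)\<in>?S. {r. entry A r k \<noteq> 0} \<times> {s})"
    using assms finite_col by (auto simp: Minf_def)
  ultimately show ?thesis unfolding Minf_def mem_Collect_eq by (rule finite_subset)
qed

lemma one_not_in_Minf: "(1 :: 'k::field bmat) \<notin> Minf"
proof
  assume "(1 :: 'k bmat) \<in> Minf"
  moreover have "{(r, s). entry (1 :: 'k bmat) r s \<noteq> 0} = range (\<lambda>n. (n, n))"
    by transfer (auto split: if_splits)
  ultimately have "finite (range (\<lambda>n :: nat. (n, n)))" by (simp add: Minf_def)
  then show False by (simp add: finite_image_iff inj_on_def)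
qed

quotient_type (overloaded) 'k qmat = "'k::field bmat" / "\<lambda>A B. A - B \<in> Minf"
  morphisms rep_qmat qproj
proof (rule equivpI)
  show "reflp (\<lambda>A B :: 'k bmat. A - B \<in> Minf)"
    by (simp add: reflp_def Minf_zero)
  show "symp (\<lambda>A B :: 'k bmat. A - B \<in> Minf)"
    by (rule sympI) (metis Minf_uminus minus_diff_eq)
  show "transp (\<lambda>A B :: 'k bmat. A - B \<in> Minf)"
  proof (rule transpI)
    fix A B C :: "'k bmat"
    assume "A - B \<in> Minf" and "B - C \<in> Minf"
    then have "(A - B) + (B - C) \<in> Minf" by (rule Minf_add)
    then show "A - C \<in> Minf" by simp
  qed
qed

instantiation qmat :: (field) ring_1
begin

lift_definition zero_qmat :: "'a qmat" is 0 .

lift_definition one_qmat :: "'a qmat" is 1 .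

lift_definition plus_qmat :: "'a qmat \<Rightarrow> 'a qmat \<Rightarrow> 'a qmat" is "(+)"
  by (metis Minf_add add_diff_add)

lift_definition uminus_qmat :: "'a qmat \<Rightarrow> 'a qmat" is uminus
  by (metis Minf_uminus minus_diff_minus)

lift_definition minus_qmat :: "'a qmat \<Rightarrow> 'a qmat \<Rightarrow> 'a qmat" is "(-)"
proof -
  fix A A' B B' :: "'a bmat"
  assume "A - A' \<in> Minf" and "B - B' \<in> Minf"
  then have "(A - A') + - (B - B') \<in> Minf" by (intro Minf_add Minf_uminus)
  then show "A - B - (A' - B') \<in> Minf" by (simp add: algebra_simps)
qed

lift_definition times_qmat :: "'a qmat \<Rightarrow> 'a qmat \<Rightarrow> 'a qmat" is "(*)"
proof -
  fix A A' B B' :: "'a bmat"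
  assume "A - A' \<in> Minf" and "B - B' \<in> Minf"
  then have "(A - A') * B + A' * (B - B') \<in> Minf"
    by (intro Minf_add Minf_mult_left Minf_mult_right)
  then show "A * B - A' * B' \<in> Minf" by (simp add: algebra_simps)
qed

instance
proof
  fix a b c :: "'a qmat"
  show "a + b + c = a + (b + c)" by transfer (simp add: add.assoc Minf_zero)
  show "a + b = b + a" by transfer (simp add: add.commute Minf_zero)
  show "0 + a = a" by transfer (simp add: Minf_zero)
  show "- a + a = 0" by transfer (simp add: Minf_zero)
  show "a - b = a + - b" by transfer (simp add: Minf_zero)
  show "a * b * c = a * (b * c)" by transfer (simp add: mult.assoc Minf_zero)
  show "1 * a = a" by transfer (simp add: Minf_zero)
  show "a * 1 = a" by transfer (simp add: Minf_zero)
  show "(a + b) * c = a * c + b * c" by transfer (simp add: distrib_right Minf_zero)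
  show "a * (b + c) = a * b + a * c" by transfer (simp add: distrib_left Minf_zero)
  show "(0 :: 'a qmat) \<noteq> 1"
    by transfer (metis Minf_uminus one_not_in_Minf diff_0 minus_minus)
qed

end

lift_definition qmat_scale :: "'k::field \<Rightarrow> 'k qmat \<Rightarrow> 'k qmat" is bmat_scale
proof -
  fix c :: 'k and A A' :: "'k bmat"
  assume "A - A' \<in> Minf"
  then have "bmat_scale c (A - A') \<in> Minf" by (rule Minf_scale)
  moreover have "bmat_scale c (A - A') = bmat_scale c A - bmat_scale c A'"
    by (rule bmat_eqI) (simp add: entry_scale entry_minus algebra_simps)
  ultimately show "bmat_scale c A - bmat_scale c A' \<in> Minf" by simp
qed

lemma unital_algebra_qmat: "unital_algebra (qmat_scale :: 'k::field \<Rightarrow> _)"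
proof -
  interpret B: unital_algebra "bmat_scale :: 'k \<Rightarrow> _" by (rule unital_algebra_bmat)
  note B = B.vector_space_assms B.scale_mult_left B.scale_mult_right Minf_zero
  show ?thesis
    by standard (transfer; simp add: B)+
qed

lemma unital_algebra_hom_qproj:
  "unital_algebra_hom bmat_scale qmat_scale (qproj :: 'k::field bmat \<Rightarrow> _)"
proof -
  interpret B: unital_algebra "bmat_scale :: 'k \<Rightarrow> _" by (rule unital_algebra_bmat)
  interpret Q: unital_algebra "qmat_scale :: 'k \<Rightarrow> _" by (rule unital_algebra_qmat)
  show ?thesis
    unfolding unital_algebra_hom_def
  proof (intro conjI allI)
    show "Vector_Spaces.linear bmat_scale qmat_scale (qproj :: 'k bmat \<Rightarrow> _)"
      by unfold_locales (simp_all add: plus_qmat.abs_eq qmat_scale.abs_eq)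
  qed (simp_all add: times_qmat.abs_eq one_qmat_def)
qed

lemma qproj_eq_iff: "qproj A = qproj B \<longleftrightarrow> A - B \<in> Minf"
  by (rule qmat.abs_eq_iff)


section \<open>Index\<close>

text \<open>As elsewhere for HOL-Algebra modules, the fields \<^const>\<open>mult\<close> and \<^const>\<open>one\<close> of a
  \<^const>\<open>module\<close> record play no role for a vector space.\<close>

definition col_space :: "('k::field, nat \<Rightarrow>\<^sub>0 'k) module" where
  "col_space = \<lparr>carrier = UNIV, mult = (\<lambda>_ _. 0), one = 0, zero = 0, add = (+),
     smult = (\<lambda>c. Poly_Mapping.map ((*) c))\<rparr>"

lift_definition mat_vec :: "'k::field bmat \<Rightarrow> (nat \<Rightarrow>\<^sub>0 'k) \<Rightarrow> (nat \<Rightarrow>\<^sub>0 'k)"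
  is "\<lambda>T v r. \<Sum>k | v k \<noteq> 0. T r k * v k"
proof -
  fix T :: "nat \<Rightarrow> nat \<Rightarrow> 'k" and v :: "nat \<Rightarrow> 'k"
  assume T: "(\<forall>r. finite {s. T r s \<noteq> 0}) \<and> (\<forall>s. finite {r. T r s \<noteq> 0})"
    and v: "finite {k. v k \<noteq> 0}"
  have "{r. (\<Sum>k | v k \<noteq> 0. T r k * v k) \<noteq> 0} \<subseteq> (\<Union>k\<in>{k. v k \<noteq> 0}. {r. T r k \<noteq> 0})"
    by (auto elim!: sum.not_neutral_contains_not_neutral)
  moreover have "finite (\<Union>k\<in>{k. v k \<noteq> 0}. {r. T r k \<noteq> 0})"
    using T v by blast
  ultimately show "finite {r. (\<Sum>k | v k \<noteq> 0. T r k * v k) \<noteq> 0}"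
    by (rule finite_subset)
qed

definition quotient_space :: "('k, 'v) module \<Rightarrow> 'v set \<Rightarrow> ('k, 'v set) module" where
  "quotient_space V W = \<lparr>carrier = a_rcosets\<^bsub>V\<^esub> W, mult = (\<lambda>_ _. W), one = W, zero = W,
     add = set_add V, smult = (\<lambda>c C. \<Union>v\<in>C. W +>\<^bsub>V\<^esub> (c \<odot>\<^bsub>V\<^esub> v))\<rparr>"

definition ker_space :: "'k::field bmat \<Rightarrow> ('k, nat \<Rightarrow>\<^sub>0 'k) module" where
  "ker_space T = col_space\<lparr>carrier := {v. mat_vec T v = 0}\<rparr>"

definition coker_space :: "'k::field bmat \<Rightarrow> ('k, (nat \<Rightarrow>\<^sub>0 'k) set) module" where
  "coker_space T = quotient_space col_space (range (mat_vec T))"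

text \<open>Only meaningful if both spaces are finite-dimensional, in particular if \<^term>\<open>qproj T\<close> is
  invertible (\<^term>\<open>T\<close> is Fredholm).\<close>

definition index :: "'k::field bmat \<Rightarrow> int" where
  "index T = int (vectorspace.dim class_ring (ker_space T))
           - int (vectorspace.dim class_ring (coker_space T))"

text \<open>Only meaningful if \<^term>\<open>q\<close> is invertible, in which case all the matrices \<^term>\<open>T\<close> have the
  same index.\<close>

definition qindex :: "'k::field qmat \<Rightarrow> int" where
  "qindex q = (THE n. \<forall>T. qproj T = q \<longrightarrow> index T = n)"


section \<open>Extensions by the finite matrices\<close>

text \<open>The map \<^term>\<open>i\<close> is only relevant on \<^const>\<open>Minf\<close>.\<close>

locale Minf_extension =
  E: unital_algebra scaleE + A: unital_algebra scaleA
  for scaleE :: "'k::field \<Rightarrow> 'e::ring_1 \<Rightarrow> 'e"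
    and scaleA :: "'k \<Rightarrow> 'a::ring_1 \<Rightarrow> 'a" +
  fixes i :: "'k bmat \<Rightarrow> 'e" and p :: "'e \<Rightarrow> 'a"
  assumes i_add: "X \<in> Minf \<Longrightarrow> Y \<in> Minf \<Longrightarrow> i (X + Y) = i X + i Y"
    and i_mult: "X \<in> Minf \<Longrightarrow> Y \<in> Minf \<Longrightarrow> i (X * Y) = i X * i Y"
    and i_scale: "X \<in> Minf \<Longrightarrow> i (bmat_scale c X) = scaleE c (i X)"
    and p_hom: "unital_algebra_hom scaleE scaleA p"
    and i_inj: "inj_on i Minf"
    and exact: "i ` Minf = {a. p a = 0}"
    and p_surj: "surj p"

definition faithful_ideal :: "'e::ring_1 set \<Rightarrow> bool" where
  "faithful_ideal I \<longleftrightarrow>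
     (\<forall>a. (\<lambda>x. a * x) ` I = {0} \<longrightarrow> a = 0) \<and> (\<forall>b. (\<lambda>x. x * b) ` I = {0} \<longrightarrow> b = 0)"

locale faithful_Minf_extension = Minf_extension +
  assumes faithful: "faithful_ideal (i ` Minf)"

definition trivial_extension ::
  "('k::field \<Rightarrow> 'e::ring_1 \<Rightarrow> 'e) \<Rightarrow> ('k \<Rightarrow> 'a::ring_1 \<Rightarrow> 'a) \<Rightarrow> ('e \<Rightarrow> 'a) \<Rightarrow> bool" where
  "trivial_extension scaleE scaleA p \<longleftrightarrow>
     (\<exists>\<rho>. unital_algebra_hom scaleA scaleE \<rho> \<and> p \<circ> \<rho> = id)"

definition matrix_hom :: "('k::field \<Rightarrow> 'e::ring_1 \<Rightarrow> 'e) \<Rightarrow> ('k bmat \<Rightarrow> 'e) \<Rightarrow> 'e \<Rightarrow> 'k bmat" where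
  "matrix_hom scaleE i =
     (THE \<phi>. unital_algebra_hom scaleE bmat_scale \<phi> \<and> (\<forall>X\<in>Minf. \<phi> (i X) = X))"

definition invariant ::
  "('k::field \<Rightarrow> 'e::ring_1 \<Rightarrow> 'e) \<Rightarrow> ('k bmat \<Rightarrow> 'e) \<Rightarrow> ('e \<Rightarrow> 'a::ring_1) \<Rightarrow> 'a \<Rightarrow> 'k qmat" where
  "invariant scaleE i p = (THE \<psi>. \<forall>a. \<psi> (p a) = qproj (matrix_hom scaleE i a))"


section \<open>Laurent polynomials\<close>

text \<open>\<^term>\<open>Poly_Mapping.single n c\<close> is the monomial with coefficient \<^term>\<open>c\<close> and exponent
  \<^term>\<open>n\<close>; multiplication is convolution.\<close>

type_synonym 'k laurent = "int \<Rightarrow>\<^sub>0 'k"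

definition laurent_scale :: "'k::field \<Rightarrow> 'k laurent \<Rightarrow> 'k laurent" where
  "laurent_scale c = Poly_Mapping.map ((*) c)"

definition laurent_X :: "'k::field laurent" where
  "laurent_X = Poly_Mapping.single 1 1"

lemma laurent_scale_eq_mult: "laurent_scale c f = Poly_Mapping.single 0 c * f"
  unfolding laurent_scale_def by (rule mult_map_scale_conv_mult)

lemma unital_algebra_laurent: "unital_algebra (laurent_scale :: 'k::field \<Rightarrow> _)"
proof
  fix c d :: 'k and f g :: "'k laurent"
  show "laurent_scale c (f + g) = laurent_scale c f + laurent_scale c g"
    by (simp add: laurent_scale_eq_mult distrib_left)
  show "laurent_scale (c + d) f = laurent_scale c f + laurent_scale d f"
    by (simp add: laurent_scale_eq_mult single_add distrib_right)
  show "laurent_scale c (laurent_scale d f) = laurent_scale (c * d) f"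
    by (simp add: laurent_scale_eq_mult mult_single flip: mult.assoc)
  show "laurent_scale 1 f = f"
    by (simp add: laurent_scale_eq_mult)
  show "laurent_scale c f * g = laurent_scale c (f * g)"
    by (simp add: laurent_scale_eq_mult mult.assoc)
  show "f * laurent_scale c g = laurent_scale c (f * g)"
    by (simp add: laurent_scale_eq_mult mult.left_commute)
qed

end

theory Submission
  imports Defs
begin

text \<open>
Let \<open>\<phi>\<close> be the homomorphism from the extension E to the row- and column-finite matrices that is
the identity on the finite matrices. Faithfulness makes \<open>\<phi>\<close> injective (\<open>inj_matrix_hom\<close>), and its
image is closed under perturbation by finite matrices (\<open>matrix_hom_lift\<close>). If a lifts the
indeterminate x, then \<open>\<phi>\<close> a is a Fredholm matrix which represents \<open>\<psi>\<close> x.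

A homomorphic section exists if and only if x lifts to a unit of E: the image of x under a section is
such a unit, and conversely a unit may be substituted for x in Laurent polynomials
(\<open>hom_laurent_eval\<close>). In terms of matrices, x lifts to a unit if and only if \<open>\<psi>\<close> x is represented by an
invertible matrix; the inverse matrix is again in the image of \<open>\<phi>\<close>, since it represents \<open>\<psi>\<close> of the
inverse of x.

It remains to see that a Fredholm matrix T is a finite perturbation of an invertible matrix if and
only if its index is 0. For all large N the columns of T from number N on are linearly
independent and have a span of finite codimension c (\<open>fredholm_tail_basis\<close>). The index is then
N - c (\<open>index_tail_basis\<close>). As a finite perturbation changes only finitely many columns, this
formula shows that the index is invariant under such perturbations (\<open>index_cong_Minf\<close>); and it is 0 for
invertible T, where N = c = 0 is possible. If conversely the index is 0, then c = N, and there
are exactly as many vectors missing to a basis as there are columns in front; putting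
the missing vectors into these columns gives an invertible matrix (\<open>fredholm_index_0_invertible\<close>).
\<close>

section \<open>Dimension and codimension\<close>

context vector_space
begin

text \<open>Dimensions of kernels and cokernels are dimensions of structures with an explicit carrier, whereas
all the arguments about bases take place inside one ambient vector space. The next two lemmas are the
bridge: both the kernel (a subset) and the cokernel (a set of cosets) are images of a subspace of the
ambient space under a map that respects the operations.\<close>

lemma vectorspace_linear_image:
  fixes M :: "('a, 'c) module"
  assumes W: "subspace W" and onto: "h ` W = carrier M"
    and add: "\<And>x y. x \<in> W \<Longrightarrow> y \<in> W \<Longrightarrow> h (x + y) = h x \<oplus>\<^bsub>M\<^esub> h y"
    and scale: "\<And>c x. x \<in> W \<Longrightarrow> h (c *s x) = c \<odot>\<^bsub>M\<^esub> h x"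
    and zero: "h 0 = \<zero>\<^bsub>M\<^esub>"
  shows "vectorspace class_ring M"
proof -
  have ex: "\<exists>x\<in>W. h x = m" if "m \<in> carrier M" for m
    using that onto by (metis imageE)
  have in_carrier: "h x \<in> carrier M" if "x \<in> W" for x
    using that onto by blast
  note W_closed = subspace_add[OF W] subspace_scale[OF W] subspace_0[OF W] subspace_neg[OF W]
  have "abelian_group M"
  proof (rule abelian_groupI)
    show "\<zero>\<^bsub>M\<^esub> \<in> carrier M" using in_carrier[OF W_closed(3)] zero by simp
    fix a assume "a \<in> carrier M"
    then obtain x where x: "x \<in> W" "a = h x" using ex by blast
    show "\<zero>\<^bsub>M\<^esub> \<oplus>\<^bsub>M\<^esub> a = a"
      using add[OF W_closed(3) x(1)] x zero by simp
    show "\<exists>y\<in>carrier M. y \<oplus>\<^bsub>M\<^esub> a = \<zero>\<^bsub>M\<^esub>"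
      using add[of "- x" x] x zero in_carrier W_closed by (intro bexI[of _ "h (- x)"]) auto
    fix b assume "b \<in> carrier M"
    then obtain y where y: "y \<in> W" "b = h y" using ex by blast
    show "a \<oplus>\<^bsub>M\<^esub> b \<in> carrier M"
      using x y add in_carrier W_closed(1) by metis
    show "a \<oplus>\<^bsub>M\<^esub> b = b \<oplus>\<^bsub>M\<^esub> a"
      using x y add by (metis add.commute)
    fix c assume "c \<in> carrier M"
    then obtain z where z: "z \<in> W" "c = h z" using ex by blast
    show "a \<oplus>\<^bsub>M\<^esub> b \<oplus>\<^bsub>M\<^esub> c = a \<oplus>\<^bsub>M\<^esub> (b \<oplus>\<^bsub>M\<^esub> c)"
      using x y z by (simp add: W_closed add.assoc flip: add)
  qed
  moreover have "cring (class_ring :: 'a ring)" ..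
  ultimately have "Module.module class_ring M"
  proof (intro moduleI)
    fix a b :: 'a and m assume "m \<in> carrier M"
    then obtain x where x: "x \<in> W" "m = h x" using ex by blast
    show "a \<odot>\<^bsub>M\<^esub> m \<in> carrier M"
      using x in_carrier[of "a *s x"] by (simp add: W_closed scale)
    show "(a \<oplus>\<^bsub>class_ring\<^esub> b) \<odot>\<^bsub>M\<^esub> m = (a \<odot>\<^bsub>M\<^esub> m) \<oplus>\<^bsub>M\<^esub> (b \<odot>\<^bsub>M\<^esub> m)"
      using x by (simp add: W_closed scale_left_distrib flip: scale add)
    show "(a \<otimes>\<^bsub>class_ring\<^esub> b) \<odot>\<^bsub>M\<^esub> m = a \<odot>\<^bsub>M\<^esub> (b \<odot>\<^bsub>M\<^esub> m)"
      using x by (simp add: W_closed flip: scale)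
    show "\<one>\<^bsub>class_ring\<^esub> \<odot>\<^bsub>M\<^esub> m = m"
      using x by (simp flip: scale)
    fix n assume "n \<in> carrier M"
    then obtain y where y: "y \<in> W" "n = h y" using ex by blast
    show "a \<odot>\<^bsub>M\<^esub> (m \<oplus>\<^bsub>M\<^esub> n) = (a \<odot>\<^bsub>M\<^esub> m) \<oplus>\<^bsub>M\<^esub> (a \<odot>\<^bsub>M\<^esub> n)"
      using x y by (simp add: W_closed scale_right_distrib flip: scale add)
  qed auto
  then show ?thesis
    by (simp add: vectorspace_def class_field)
qed

lemma dim_linear_image:
  fixes M :: "('a, 'c) module"
  assumes fin: "finite B" and indep: "independent B"
    and inj: "inj_on h (span B)" and onto: "h ` span B = carrier M"
    and add: "\<And>x y. x \<in> span B \<Longrightarrow> y \<in> span B \<Longrightarrow> h (x + y) = h x \<oplus>\<^bsub>M\<^esub> h y"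
    and scale: "\<And>c x. x \<in> span B \<Longrightarrow> h (c *s x) = c \<odot>\<^bsub>M\<^esub> h x"
    and zero: "h 0 = \<zero>\<^bsub>M\<^esub>"
  shows "vectorspace.dim class_ring M = card B"
proof -
  interpret M: vectorspace class_ring M
    by (rule vectorspace_linear_image[OF subspace_span onto add scale zero])
  have inj_B: "inj_on h B"
    using inj inj_on_subset span_superset by blast
  have B_sub: "h ` B \<subseteq> carrier M"
    using onto span_superset by blast
  have lincomb: "M.lincomb a (h ` A) = h (\<Sum>b\<in>A. a (h b) *s b)" if A: "A \<subseteq> B" for a A
    using finite_subset[OF A fin] A
  proof (induction A)
    case empty
    then show ?case by (simp add: M.lincomb_def zero)
  next
    case (insert b A)
    have b: "b \<in> span B" and s: "(\<Sum>b\<in>A. a (h b) *s b) \<in> span B"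
      using insert.prems by (auto intro!: span_sum span_scale intro: span_base)
    have "h b \<notin> h ` A"
      using insert inj_B by (meson inj_on_image_mem_iff insert_subset)
    then have "M.lincomb a (insert (h b) (h ` A)) = a (h b) \<odot>\<^bsub>M\<^esub> h b \<oplus>\<^bsub>M\<^esub> M.lincomb a (h ` A)"
      unfolding M.lincomb_def using insert.hyps(1) insert.prems B_sub
      by (intro M.M.finsum_insert) (auto intro!: M.smult_closed)
    then show ?case
      using insert b s by (simp add: add scale span_scale)
  qed
  have "M.basis (h ` B)"
    unfolding M.basis_def
  proof (intro conjI)
    show "M.span (h ` B) = carrier M"
    proof
      show "M.span (h ` B) \<subseteq> carrier M"
        using B_sub by (rule M.span_is_subset2)
      show "carrier M \<subseteq> M.span (h ` B)"
      proof
        fix m assume "m \<in> carrier M"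
        then obtain x where x: "x \<in> span B" "m = h x" using onto by blast
        then obtain r where r: "x = (\<Sum>b\<in>B. r b *s b)"
          using span_finite[OF fin] by auto
        have "m = M.lincomb (r \<circ> the_inv_into B h) (h ` B)"
          by (subst lincomb) (auto simp: x r the_inv_into_f_f[OF inj_B] intro!: sum.cong arg_cong[of _ _ h])
        then show "m \<in> M.span (h ` B)"
          unfolding M.span_def using fin by auto
      qed
    qed
    show "M.lin_indpt (h ` B)"
    proof
      assume "M.lin_dep (h ` B)"
      then obtain A' a v where A': "finite A'" "A' \<subseteq> h ` B" "M.lincomb a A' = \<zero>\<^bsub>M\<^esub>"
        and v: "v \<in> A'" "a v \<noteq> 0"
        unfolding M.lin_dep_def by auto
      then obtain A where A: "A \<subseteq> B" "A' = h ` A"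
        by (meson subset_imageE)
      have s: "(\<Sum>b\<in>A. a (h b) *s b) \<in> span B"
        using A by (auto intro!: span_sum span_scale intro: span_base)
      have "h (\<Sum>b\<in>A. a (h b) *s b) = h 0"
        using A' A lincomb zero by metis
      then have "(\<Sum>b\<in>A. a (h b) *s b) = 0"
        using inj s span_zero by (meson inj_onD)
      moreover obtain b where "b \<in> A" "v = h b" using v A by blast
      ultimately show False
        using independentD[OF indep finite_subset[OF A(1) fin] A(1), of "\<lambda>b. a (h b)" b] v by simp
    qed
  qed (rule B_sub)
  then have "M.dim = card (h ` B)"
    using fin by (intro M.dim_basis) auto
  then show ?thesis
    by (simp add: card_image inj_B)
qed

text \<open>If a member of one of the two sets were a combination of all the other vectors, the part of this
combination that comes from the other set would lie in both spans, hence would vanish.\<close>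

lemma independent_Un_span_disjoint:
  assumes A: "independent A" and B: "independent B" and AB: "span A \<inter> span B = {0}"
  shows "independent (A \<union> B)"
proof -
  have *: "a \<notin> span (A \<union> B - {a})"
    if "a \<in> A" and A: "independent A" and AB: "span A \<inter> span B = {0}" for a A B
  proof
    assume "a \<in> span (A \<union> B - {a})"
    then have "a \<in> span ((A - {a}) \<union> B)"
      using span_mono[of "A \<union> B - {a}" "(A - {a}) \<union> B"] by blast
    then obtain x y where xy: "a = x + y" "x \<in> span (A - {a})" "y \<in> span B"
      unfolding span_Un by auto
    have "x \<in> span A" using xy(2) span_mono[of "A - {a}" A] by blast
    then have "y \<in> span A" using xy(1) \<open>a \<in> A\<close> by (metis add_diff_cancel_left' span_base span_diff)
    then have "y = 0" using xy(3) AB by blast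
    then show False using xy \<open>a \<in> A\<close> A dependent_def by auto
  qed
  show ?thesis
    unfolding dependent_def using *[OF _ A AB] *[of _ B A] B AB by (auto simp: Un_commute Int_commute)
qed

lemma span_Int_span_of_independent:
  assumes "independent (A \<union> B)" and "A \<inter> B = {}"
  shows "span A \<inter> span B = {0}"
proof -
  have "x = 0" if x: "x \<in> span A" "x \<in> span B" for x
  proof -
    have "representation (A \<union> B) x = representation A x"
      and "representation (A \<union> B) x = representation B x"
      using assms x by (auto intro: representation_extend)
    then have "representation (A \<union> B) x b = 0" for b
      using assms(2) representation_ne_zero[of A x b] representation_ne_zero[of B x b] by auto
    moreover have "x \<in> span (A \<union> B)" using x span_mono[of A "A \<union> B"] by auto
    ultimately show "x = 0"
      using sum_nonzero_representation_eq[OF assms(1), of x] by simp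
  qed
  then show ?thesis using span_zero by auto
qed

text \<open>The codimension of a subspace is well defined even if the subspace has infinite dimension: the
projection onto the span of C along the span of A is injective on every other complement of
the span of A.\<close>

lemma complement_bases_card_le:
  assumes AB: "independent (A \<union> B)" "A \<inter> B = {}"
    and AC: "independent (A \<union> C)" "A \<inter> C = {}" "span (A \<union> C) = UNIV" and fin: "finite C"
  shows "finite B \<and> card B \<le> card C"
proof -
  interpret vector_space_pair scale scale ..
  define P where "P = construct (A \<union> C) (\<lambda>b. if b \<in> A then 0 else b)"
  have lin: "Vector_Spaces.linear scale scale P"
    unfolding P_def by (rule linear_construct[OF AC(1)])
  have P_A: "P b = 0" if "b \<in> A" for b
    unfolding P_def using that by (subst construct_basis[OF AC(1)]) auto
  have P_C: "P b = b" if "b \<in> C" for b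
    unfolding P_def using that AC(2) by (subst construct_basis[OF AC(1)]) auto
  have split: "\<exists>y\<in>span A. \<exists>z\<in>span C. x = y + z \<and> P x = z" for x
  proof -
    obtain y z where yz: "y \<in> span A" "z \<in> span C" "x = y + z"
      using AC(3) unfolding span_Un by blast
    have "P y = 0" using linear_eq_0_on_span[OF lin, of A y] P_A yz by blast
    moreover have "P z = z"
      using linear_eq_on_span[OF lin linear_ident, of C z] P_C yz by auto
    ultimately show ?thesis using yz linear_add[OF lin] by auto
  qed
  have "inj_on P (span B)"
    unfolding linear_inj_on_iff_eq_0[OF lin subspace_span]
  proof (intro ballI impI)
    fix x assume x: "x \<in> span B" "P x = 0"
    then have "x \<in> span A" using split[of x] by auto
    then show "x = 0" using span_Int_span_of_independent[OF AB] x by blast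
  qed
  moreover have "independent B" using AB(1) independent_mono by blast
  ultimately have "independent (P ` B)" and inj: "inj_on P B"
    using linear_independent_injective_image[OF lin] inj_on_subset span_superset by blast+
  moreover have "P ` B \<subseteq> span C" using split by force
  ultimately have "finite (P ` B) \<and> card (P ` B) \<le> card C"
    using independent_span_bound[OF fin] by blast
  then show ?thesis using inj by (simp add: card_image finite_image_iff)
qed

lemma complement_bases_card_eq:
  assumes "independent (A \<union> B)" "A \<inter> B = {}" "span (A \<union> B) = UNIV"
    and "independent (A \<union> C)" "A \<inter> C = {}" "span (A \<union> C) = UNIV" and "finite C"
  shows "finite B" "card B = card C"
  using complement_bases_card_le[of A B C] complement_bases_card_le[of A C B] assms by auto

end

section \<open>The action of matrices on columns and the index\<close>

abbreviation unit_col :: "nat \<Rightarrow> nat \<Rightarrow>\<^sub>0 'k::field" where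
  "unit_col j \<equiv> Poly_Mapping.single j 1"

abbreviation col_scale :: "'k::field \<Rightarrow> (nat \<Rightarrow>\<^sub>0 'k) \<Rightarrow> (nat \<Rightarrow>\<^sub>0 'k)" where
  "col_scale c \<equiv> Poly_Mapping.map ((*) c)"

lemma lookup_col_scale: "Poly_Mapping.lookup (col_scale c v) r = c * Poly_Mapping.lookup v r"
  by (simp add: Poly_Mapping.map.rep_eq when_def)

interpretation col: vector_space "col_scale :: 'k::field \<Rightarrow> _"
  by standard (auto intro!: poly_mapping_eqI simp: lookup_col_scale lookup_add algebra_simps)

interpretation col: vector_space_pair "col_scale :: 'k::field \<Rightarrow> _" "col_scale :: 'k \<Rightarrow> _" ..

lemma lookup_mat_vec:
  assumes "finite X" and "Poly_Mapping.keys v \<subseteq> X"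
  shows "Poly_Mapping.lookup (mat_vec T v) r = (\<Sum>k\<in>X. entry T r k * Poly_Mapping.lookup v k)"
proof -
  have "Poly_Mapping.lookup (mat_vec T v) r
      = (\<Sum>k | Poly_Mapping.lookup v k \<noteq> 0. entry T r k * Poly_Mapping.lookup v k)"
    by (simp add: mat_vec.rep_eq)
  also have "\<dots> = (\<Sum>k\<in>X. entry T r k * Poly_Mapping.lookup v k)"
    using assms by (intro sum.mono_neutral_left) (auto simp: keys.rep_eq)
  finally show ?thesis .
qed

lemma linear_mat_vec: "Vector_Spaces.linear col_scale col_scale (mat_vec T)"
proof (unfold_locales, goal_cases)
  case (1 v w)
  let ?X = "Poly_Mapping.keys v \<union> Poly_Mapping.keys w"
  have "Poly_Mapping.keys (v + w) \<subseteq> ?X" by (rule keys_add)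
  then show ?case
    by (intro poly_mapping_eqI)
      (simp add: lookup_mat_vec[of ?X] lookup_add sum.distrib distrib_left)
next
  case (2 c v)
  have "Poly_Mapping.keys (col_scale c v) \<subseteq> Poly_Mapping.keys v"
    by (auto simp: in_keys_iff lookup_col_scale)
  then show ?case
    by (intro poly_mapping_eqI)
      (simp add: lookup_mat_vec[of "Poly_Mapping.keys v"] lookup_col_scale sum_distrib_left mult.left_commute)
qed

interpretation mat_vec: Vector_Spaces.linear col_scale col_scale "mat_vec T" for T
  by (rule linear_mat_vec)

lemma lookup_mat_vec_unit_col:
  "Poly_Mapping.lookup (mat_vec T (unit_col j)) r = entry T r j"
  by (simp add: lookup_mat_vec[of "{j}"])

lemma bmat_eq_unit_colI:
  "(\<And>j. mat_vec A (unit_col j) = mat_vec B (unit_col j)) \<Longrightarrow> A = B"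
  by (rule bmat_eqI) (metis lookup_mat_vec_unit_col)

lemma inj_unit_col: "inj_on (unit_col :: nat \<Rightarrow> nat \<Rightarrow>\<^sub>0 'k::field) S"
  by (rule inj_onI) (metis keys_single singleton_inject one_neq_zero)

lemma unit_col_eq_iff: "unit_col i = (unit_col j :: nat \<Rightarrow>\<^sub>0 'k::field) \<longleftrightarrow> i = j"
  using inj_unit_col by (auto dest: injD)

lemma span_unit_col: "col.span (range unit_col) = (UNIV :: (nat \<Rightarrow>\<^sub>0 'k::field) set)"
proof -
  have "v \<in> col.span (range unit_col)" for v :: "nat \<Rightarrow>\<^sub>0 'k"
  proof -
    have "v = (\<Sum>k\<in>Poly_Mapping.keys v. col_scale (Poly_Mapping.lookup v k) (unit_col k))"
      by (intro poly_mapping_eqI)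
        (auto simp: lookup_sum lookup_col_scale lookup_single when_def in_keys_iff if_distrib cong: if_cong)
    also have "\<dots> \<in> col.span (range unit_col)"
      by (intro col.span_sum col.span_scale col.span_base) auto
    finally show ?thesis .
  qed
  then show ?thesis by blast
qed

lemma independent_unit_col: "col.independent (range (unit_col :: nat \<Rightarrow> nat \<Rightarrow>\<^sub>0 'k::field))"
  unfolding col.independent_explicit_module
proof (intro allI impI)
  fix t and u :: "(nat \<Rightarrow>\<^sub>0 'k) \<Rightarrow> 'k" and v
  assume t: "finite t" "t \<subseteq> range unit_col" and eq: "(\<Sum>v\<in>t. col_scale (u v) v) = 0" and v: "v \<in> t"
  then obtain k where k: "v = unit_col k" by blast
  have "0 = (\<Sum>w\<in>t. u w * Poly_Mapping.lookup w k)"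
    using arg_cong[OF eq, of "\<lambda>x. Poly_Mapping.lookup x k"] by (simp add: lookup_sum lookup_col_scale)
  also have "\<dots> = (\<Sum>w\<in>t. if w = v then u v else 0)"
  proof (intro sum.cong refl)
    fix w assume "w \<in> t"
    then obtain j where "w = unit_col j" using t(2) by blast
    then show "u w * Poly_Mapping.lookup w k = (if w = v then u v else 0)"
      using k by (auto simp: lookup_single when_def unit_col_eq_iff)
  qed
  also have "\<dots> = u v" using t v by simp
  finally show "u v = 0" by simp
qed

lemma independent_unit_col_image: "col.independent (unit_col ` S :: (nat \<Rightarrow>\<^sub>0 'k::field) set)"
  using independent_unit_col by (rule col.independent_mono) auto

lemma linear_eq_unit_colI:
  assumes "Vector_Spaces.linear col_scale col_scale f" "Vector_Spaces.linear col_scale col_scale g"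
    and "\<And>j. f (unit_col j) = g (unit_col j)"
  shows "f v = g (v :: nat \<Rightarrow>\<^sub>0 'k::field)"
  using col.linear_eq_on_span[OF assms(1,2), of "range unit_col" v] assms(3) span_unit_col by blast

lemma mat_vec_times: "mat_vec (A * B) v = mat_vec A (mat_vec B (v :: nat \<Rightarrow>\<^sub>0 'k::field))"
proof (rule linear_eq_unit_colI[where f = "mat_vec (A * B)" and g = "\<lambda>v. mat_vec A (mat_vec B v)"])
  show "Vector_Spaces.linear col_scale col_scale (\<lambda>v. mat_vec A (mat_vec B (v :: nat \<Rightarrow>\<^sub>0 'k)))"
    using Vector_Spaces.linear_compose[OF linear_mat_vec[of B] linear_mat_vec[of A]] by (simp add: o_def)
  fix j
  show "mat_vec (A * B) (unit_col j) = mat_vec A (mat_vec B (unit_col j :: nat \<Rightarrow>\<^sub>0 'k))"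
  proof (rule poly_mapping_eqI)
    fix r
    let ?X = "{k. entry A r k \<noteq> 0} \<union> {k. entry B k j \<noteq> 0}"
    have X: "finite ?X" using finite_row finite_col by blast
    show "Poly_Mapping.lookup (mat_vec (A * B) (unit_col j)) r
        = Poly_Mapping.lookup (mat_vec A (mat_vec B (unit_col j))) r"
      by (subst lookup_mat_vec[OF X])
        (auto simp: lookup_mat_vec_unit_col entry_times_superset[OF X] in_keys_iff)
  qed
qed (rule linear_mat_vec)

lemma mat_vec_one: "mat_vec 1 v = (v :: nat \<Rightarrow>\<^sub>0 'k::field)"
proof (rule linear_eq_unit_colI[where f = "mat_vec 1" and g = "\<lambda>v. v"])
  show "mat_vec 1 (unit_col j) = (unit_col j :: nat \<Rightarrow>\<^sub>0 'k)" for j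
    by (rule poly_mapping_eqI)
      (auto simp: lookup_mat_vec_unit_col one_bmat.rep_eq lookup_single when_def)
qed (auto intro: linear_mat_vec col.linear_ident)

lemma dim_ker_space:
  assumes "finite B" and "col.independent B" and "col.span B = {v. mat_vec T v = 0}"
  shows "vectorspace.dim class_ring (ker_space T) = card B"
  using assms by (intro col.dim_linear_image[where h = id]) (auto simp: ker_space_def col_space_def)

text \<open>The quotient map, restricted to a complement of the range, is a linear bijection onto the
cokernel.\<close>

lemma dim_coker_space:
  fixes T :: "'k::field bmat"
  assumes "finite C" and "col.independent C"
    and disj: "range (mat_vec T) \<inter> col.span C = {0}"
    and onto: "\<And>v. \<exists>u. \<exists>w\<in>col.span C. v = mat_vec T u + w"
  shows "vectorspace.dim class_ring (coker_space T) = card C"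
proof (rule col.dim_linear_image[OF assms(1,2)])
  define R where "R = range (mat_vec T)"
  define h where "h v = (\<lambda>r. r + v) ` R" for v
  have R: "col.subspace R"
    unfolding R_def using mat_vec.subspace_image col.subspace_UNIV by blast
  have R_closed: "0 \<in> R" "x \<in> R \<Longrightarrow> y \<in> R \<Longrightarrow> x + y \<in> R" "x \<in> R \<Longrightarrow> y \<in> R \<Longrightarrow> x - y \<in> R"
    "x \<in> R \<Longrightarrow> col_scale c x \<in> R" for x y c
    using R by (auto intro: col.subspace_0 col.subspace_add col.subspace_diff col.subspace_scale)
  have mem_h: "x \<in> h v \<longleftrightarrow> x - v \<in> R" for x v
    unfolding h_def by (auto simp: image_iff) (metis diff_add_cancel)
  have h_eq: "h v = h w \<longleftrightarrow> v - w \<in> R" for v w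
  proof
    assume "h v = h w"
    moreover have "v \<in> h v" using R_closed by (simp add: mem_h)
    ultimately show "v - w \<in> R" by (simp add: mem_h)
  next
    assume vw: "v - w \<in> R"
    have "x - v \<in> R \<longleftrightarrow> x - w \<in> R" for x
      using R_closed(2)[OF vw, of "x - v"] R_closed(3)[OF _ vw, of "x - w"] by (auto simp: algebra_simps)
    then show "h v = h w" by (auto simp: mem_h)
  qed
  have r_coset: "R +>\<^bsub>col_space\<^esub> v = h v" for v
    by (auto simp: a_r_coset_def' col_space_def h_def)
  show "inj_on h (col.span C)"
  proof (rule inj_onI)
    fix x y assume "x \<in> col.span C" "y \<in> col.span C" "h x = h y"
    then have "x - y \<in> R \<inter> col.span C" using col.span_diff by (auto simp: h_eq)
    then show "x = y" using disj by (simp add: R_def)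
  qed
  have "h ` col.span C = range h"
  proof -
    have "h v \<in> h ` col.span C" for v
    proof -
      obtain u w where "w \<in> col.span C" "v = mat_vec T u + w" using onto by blast
      moreover from this have "h v = h w" by (simp add: h_eq R_def)
      ultimately show ?thesis by blast
    qed
    then show ?thesis by blast
  qed
  also have "range h = carrier (coker_space T)"
    by (auto simp: coker_space_def quotient_space_def A_RCOSETS_def' r_coset[unfolded R_def] col_space_def
        simp flip: R_def r_coset)
  finally show "h ` col.span C = carrier (coker_space T)" .
  show "h 0 = \<zero>\<^bsub>coker_space T\<^esub>"
    by (simp add: coker_space_def quotient_space_def h_def R_def)
  fix x :: "nat \<Rightarrow>\<^sub>0 'k"
  show "h (x + y) = h x \<oplus>\<^bsub>coker_space T\<^esub> h y" for y
  proof -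
    have "h x \<oplus>\<^bsub>coker_space T\<^esub> h y = (\<Union>a\<in>h x. \<Union>b\<in>h y. {a + b})"
      by (simp add: coker_space_def quotient_space_def set_add_def' col_space_def)
    also have "\<dots> = h (x + y)"
    proof safe
      fix a b assume "a \<in> h x" "b \<in> h y"
      then show "a + b \<in> h (x + y)"
        using R_closed(2)[of "a - x" "b - y"] by (simp add: mem_h algebra_simps)
    next
      fix c assume "c \<in> h (x + y)"
      then have "c - y \<in> h x" "y \<in> h y" using R_closed by (simp_all add: mem_h algebra_simps)
      then show "c \<in> (\<Union>a\<in>h x. \<Union>b\<in>h y. {a + b})" by force
    qed
    finally show ?thesis ..
  qed
  show "h (col_scale c x) = c \<odot>\<^bsub>coker_space T\<^esub> h x" for c
  proof -
    have "c \<odot>\<^bsub>coker_space T\<^esub> h x = (\<Union>v\<in>h x. h (col_scale c v))"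
      by (simp add: coker_space_def quotient_space_def r_coset flip: R_def) (simp add: col_space_def)
    also have "\<dots> = (\<Union>v\<in>h x. h (col_scale c x))"
      using R_closed(4)
      by (intro SUP_cong refl) (simp add: h_eq mem_h flip: col.scale_right_diff_distrib)
    also have "\<dots> = h (col_scale c x)"
      using R_closed(1) by (auto simp: h_def)
    finally show ?thesis ..
  qed
qed

text \<open>A tail basis records that the columns of T from number N on are linearly independent and
that the span of C is a complement of their span, which therefore has codimension
card C. Finite perturbations of T do not affect this if N is chosen large enough to avoid
the columns that they change.\<close>

definition tail_basis :: "'k::field bmat \<Rightarrow> nat \<Rightarrow> (nat \<Rightarrow>\<^sub>0 'k) set \<Rightarrow> bool" where
  "tail_basis T N C \<longleftrightarrow>
     inj_on (\<lambda>j. mat_vec T (unit_col j)) {N..} \<and> finite C \<and>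
     (\<lambda>j. mat_vec T (unit_col j)) ` {N..} \<inter> C = {} \<and>
     col.independent ((\<lambda>j. mat_vec T (unit_col j)) ` {N..} \<union> C) \<and>
     col.span ((\<lambda>j. mat_vec T (unit_col j)) ` {N..} \<union> C) = UNIV"

text \<open>The restriction of T to the span W of the basis vectors from number N on is injective
with a cokernel of dimension card C, so it has index - card C; extending a map to N
further dimensions raises the index by N. Concretely, a basis K of the kernel together with W is
completed by D to a basis of the whole space, and the images of W and D form a basis of the
range, which is completed by C'. Counting complements of W before, and complements of the
image of W after applying T, gives card K + card D = N and
card D + card C' = card C.\<close>

lemma index_tail_basis:
  fixes T :: "'k::field bmat"
  assumes "tail_basis T N C"
  shows "index T = int N - int (card C)"
proof -
  let ?K = "{v. mat_vec T v = 0}"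
  let ?W = "unit_col ` {N..} :: (nat \<Rightarrow>\<^sub>0 'k) set" and ?F = "unit_col ` {..<N} :: (nat \<Rightarrow>\<^sub>0 'k) set"
  have TW: "(\<lambda>j. mat_vec T (unit_col j)) ` {N..} = mat_vec T ` ?W" by auto
  have C: "finite C" "mat_vec T ` ?W \<inter> C = {}" "col.independent (mat_vec T ` ?W \<union> C)"
    "col.span (mat_vec T ` ?W \<union> C) = UNIV"
    using assms unfolding tail_basis_def TW by auto
  have "inj_on (mat_vec T) ?W"
    using assms inj_on_imageI[of "mat_vec T" unit_col "{N..}"] by (simp add: tail_basis_def o_def)
  moreover have "col.independent (mat_vec T ` ?W)"
    using C(3) by (rule col.independent_mono) auto
  ultimately have inj_W: "inj_on (mat_vec T) (col.span ?W)"
    using mat_vec.inj_on_span_independent_image by blast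
  obtain K where K: "K \<subseteq> ?K" "col.independent K" "?K \<subseteq> col.span K"
    using col.maximal_independent_subset by blast
  then have span_K: "col.span K = ?K"
    using col.span_minimal[OF K(1) mat_vec.subspace_kernel] by blast
  have "x = 0" if "x \<in> col.span K" "x \<in> col.span ?W" for x
  proof -
    have "mat_vec T x = 0" using that(1) span_K by simp
    then show "x = 0"
      using inj_W[unfolded mat_vec.inj_on_iff_eq_0[OF col.subspace_span]] that(2) by simp
  qed
  then have KW: "col.span K \<inter> col.span ?W = {0}"
    using col.span_zero by blast
  have KW_disj: "K \<inter> ?W = {}"
  proof -
    have "K \<inter> ?W \<subseteq> {0}"
      using Int_mono[OF col.span_superset[of K] col.span_superset[of ?W]] KW by simp
    moreover have "0 \<notin> K" using K(2) col.dependent_zero by metis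
    ultimately show ?thesis by auto
  qed
  obtain B where B: "K \<union> ?W \<subseteq> B" "col.independent B" "UNIV \<subseteq> col.span B"
    by (rule col.maximal_independent_subset_extend[OF subset_UNIV
        col.independent_Un_span_disjoint[OF K(2) independent_unit_col_image KW]])
  define D where "D = B - (K \<union> ?W)"
  have B_eq: "B = ?W \<union> (K \<union> D)" "B = K \<union> (?W \<union> D)" using B(1) D_def by auto
  have D_disj: "D \<inter> K = {}" "D \<inter> ?W = {}" by (auto simp: D_def)
  have W_F: "?W \<union> ?F = range unit_col"
  proof -
    have "{N..} \<union> {..<N} = UNIV" by auto
    then show ?thesis by (metis image_Un)
  qed
  have "?W \<inter> ?F = {}" by (auto simp: unit_col_eq_iff)
  moreover have "?W \<inter> (K \<union> D) = {}" using KW_disj D_disj by auto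
  moreover have "col.independent (?W \<union> (K \<union> D))" "col.span (?W \<union> (K \<union> D)) = UNIV"
    using B B_eq(1) by auto
  moreover have "finite ?F" by simp
  ultimately have fin: "finite (K \<union> D)" and "card (K \<union> D) = card ?F"
    using col.complement_bases_card_eq[of ?W "K \<union> D" ?F] independent_unit_col span_unit_col
    unfolding W_F by metis+
  then have card_KD: "card K + card D = N"
    using D_disj(1) by (subst card_Un_disjoint[symmetric])
      (auto simp: card_image[OF inj_unit_col])

  \<comment> \<open>T maps the span of W and D bijectively onto its range.\<close>
  have WD_K: "col.span (?W \<union> D) \<inter> col.span K = {0}"
    by (rule col.span_Int_span_of_independent) (use B(2) B_eq(2) KW_disj D_disj in \<open>auto simp: Un_ac\<close>)
  have inj_WD: "inj_on (mat_vec T) (col.span (?W \<union> D))"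
    unfolding mat_vec.inj_on_iff_eq_0[OF col.subspace_span]
  proof (intro ballI impI)
    fix x assume "x \<in> col.span (?W \<union> D)" "mat_vec T x = 0"
    then have "x \<in> col.span (?W \<union> D) \<inter> col.span K" using span_K by simp
    then show "x = 0" unfolding WD_K by simp
  qed
  then have inj_WD': "inj_on (mat_vec T) (?W \<union> D)"
    using inj_on_subset col.span_superset by blast
  have indep_TWD: "col.independent (mat_vec T ` (?W \<union> D))"
    using mat_vec.independent_injective_image[OF _ inj_WD] B(2) B_eq(2) col.independent_mono by blast
  have range_T: "range (mat_vec T) = col.span (mat_vec T ` (?W \<union> D))"
  proof -
    have "range (mat_vec T) = col.span (mat_vec T ` B)"
      using B(3) by (simp add: mat_vec.span_image top.extremum_unique)
    also have "\<dots> \<subseteq> col.span (insert 0 (mat_vec T ` (?W \<union> D)))"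
      using K(1) by (intro col.span_mono) (auto simp: B_eq(2))
    also have "\<dots> = col.span (mat_vec T ` (?W \<union> D))" by (rule col.span_insert_0)
    finally show ?thesis
      using mat_vec.span_image[of T "?W \<union> D"] by blast
  qed
  obtain B' where B': "mat_vec T ` (?W \<union> D) \<subseteq> B'" "col.independent B'" "UNIV \<subseteq> col.span B'"
    by (rule col.maximal_independent_subset_extend[OF subset_UNIV indep_TWD])
  define C' where "C' = B' - mat_vec T ` (?W \<union> D)"
  have B'_eq: "B' = mat_vec T ` ?W \<union> (mat_vec T ` D \<union> C')" "B' = mat_vec T ` (?W \<union> D) \<union> C'"
    using B'(1) C'_def by auto
  have C'_disj: "mat_vec T ` (?W \<union> D) \<inter> C' = {}" by (auto simp: C'_def)
  have TD_disj: "mat_vec T ` ?W \<inter> mat_vec T ` D = {}"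
    using inj_on_image_Int[OF inj_WD', of ?W D] D_disj(2) by (simp add: Int_commute)
  have "mat_vec T ` ?W \<inter> (mat_vec T ` D \<union> C') = {}" using TD_disj C'_disj unfolding image_Un by blast
  moreover have "col.independent (mat_vec T ` ?W \<union> (mat_vec T ` D \<union> C'))"
    and "col.span (mat_vec T ` ?W \<union> (mat_vec T ` D \<union> C')) = UNIV"
    using B' B'_eq(1) by auto
  ultimately have finC': "finite (mat_vec T ` D \<union> C')" and "card (mat_vec T ` D \<union> C') = card C"
    using col.complement_bases_card_eq[of "mat_vec T ` ?W" "mat_vec T ` D \<union> C'" C] C by metis+
  moreover have "card (mat_vec T ` D) = card D"
    using inj_WD' by (intro card_image) (auto simp: inj_on_Un)
  moreover have "card (mat_vec T ` D \<union> C') = card (mat_vec T ` D) + card C'"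
    using finC' C'_disj unfolding image_Un by (intro card_Un_disjoint) auto
  ultimately have card_DC': "card D + card C' = card C" by simp

  have "vectorspace.dim class_ring (ker_space T) = card K"
    using fin K(2) span_K by (intro dim_ker_space) auto
  moreover have "vectorspace.dim class_ring (coker_space T) = card C'"
  proof (rule dim_coker_space)
    show "finite C'" using finC' by simp
    show "col.independent C'" using B'(2) B'_eq(2) col.independent_mono by blast
    show "range (mat_vec T) \<inter> col.span C' = {0}"
      unfolding range_T using B'(2) B'_eq(2) C'_disj by (intro col.span_Int_span_of_independent) auto
    fix v
    have "v \<in> col.span (mat_vec T ` (?W \<union> D) \<union> C')" using B'(3) B'_eq(2) by auto
    then show "\<exists>u. \<exists>w\<in>col.span C'. v = mat_vec T u + w"
      unfolding col.span_Un range_T[symmetric] by blast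
  qed
  ultimately show ?thesis
    unfolding index_def using card_KD card_DC' by simp
qed

section \<open>Fredholm matrices\<close>

text \<open>Invertibility of the class of T in the quotient algebra, spelled out on representatives.\<close>

definition fredholm :: "'k::field bmat \<Rightarrow> bool" where
  "fredholm T \<longleftrightarrow> (\<exists>S. S * T - 1 \<in> Minf \<and> T * S - 1 \<in> Minf)"

lemma mat_vec_minus: "mat_vec (A - B) v = mat_vec A v - mat_vec B (v :: nat \<Rightarrow>\<^sub>0 'k::field)"
proof (rule linear_eq_unit_colI[where f = "mat_vec (A - B)" and g = "\<lambda>v. mat_vec A v - mat_vec B v"])
  show "mat_vec (A - B) (unit_col j) = mat_vec A (unit_col j) - mat_vec B (unit_col j)" for j
    by (rule poly_mapping_eqI) (simp add: lookup_minus lookup_mat_vec_unit_col entry_minus)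
qed (intro linear_mat_vec col.linear_compose_sub)+

text \<open>Since every column is finite anyway, a matrix is finite as soon as almost all of its columns vanish.\<close>

lemma Minf_iff_unit_col:
  "G \<in> Minf \<longleftrightarrow> (\<exists>N. \<forall>j\<ge>N. mat_vec G (unit_col j) = (0 :: nat \<Rightarrow>\<^sub>0 'k::field))"
proof
  assume "G \<in> Minf"
  then have "finite (snd ` {(r, s). entry G r s \<noteq> 0})" by (simp add: Minf_def)
  then obtain N where N: "\<forall>s \<in> snd ` {(r, s). entry G r s \<noteq> 0}. s < N"
    using finite_nat_set_iff_bounded by blast
  have "mat_vec G (unit_col j) = 0" if "N \<le> j" for j
    by (rule poly_mapping_eqI) (use N that in \<open>force simp: lookup_mat_vec_unit_col\<close>)
  then show "\<exists>N. \<forall>j\<ge>N. mat_vec G (unit_col j) = 0" by blast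
next
  assume "\<exists>N. \<forall>j\<ge>N. mat_vec G (unit_col j) = 0"
  then obtain N where N: "\<And>j. N \<le> j \<Longrightarrow> mat_vec G (unit_col j) = 0" by blast
  have "entry G r s = 0" if "N \<le> s" for r s
    using N[OF that] lookup_mat_vec_unit_col[of G s r] by simp
  then have "{(r, s). entry G r s \<noteq> 0} \<subseteq> (\<Union>s<N. {r. entry G r s \<noteq> 0} \<times> {s})"
    by (auto simp: not_le[symmetric])
  moreover have "finite (\<Union>s<N. {r. entry G r s \<noteq> 0} \<times> {s})"
    using finite_col by blast
  ultimately show "G \<in> Minf" unfolding Minf_def by (simp add: finite_subset)
qed

lemma bmat_replace_columns:
  fixes T :: "'k::field bmat"
  obtains U where "\<And>j. j < N \<Longrightarrow> mat_vec U (unit_col j) = f j"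
    and "\<And>j. N \<le> j \<Longrightarrow> mat_vec U (unit_col j) = mat_vec T (unit_col j)"
proof
  let ?u = "\<lambda>r s. if s < N then Poly_Mapping.lookup (f s) r else entry T r s"
  have "finite {s. ?u r s \<noteq> 0}" for r
    by (rule finite_subset[of _ "{..<N} \<union> {s. entry T r s \<noteq> 0}"]) (auto intro: finite_row)
  moreover have "finite {r. ?u r s \<noteq> 0}" for s
    by (cases "s < N") (simp_all add: finite_col)
  ultimately have entry: "entry (Abs_bmat ?u) r s = ?u r s" for r s
    by (subst Abs_bmat_inverse) auto
  show "mat_vec (Abs_bmat ?u) (unit_col j) = f j" if "j < N" for j
    by (rule poly_mapping_eqI) (simp add: lookup_mat_vec_unit_col entry that)
  show "mat_vec (Abs_bmat ?u) (unit_col j) = mat_vec T (unit_col j)" if "N \<le> j" for j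
    by (rule poly_mapping_eqI) (use that in \<open>simp add: lookup_mat_vec_unit_col entry\<close>)
qed

lemma tail_basis_cong:
  assumes "tail_basis T N C" and "\<And>j. N \<le> j \<Longrightarrow> mat_vec T' (unit_col j) = mat_vec T (unit_col j)"
  shows "tail_basis T' N C"
proof -
  have "(\<lambda>j. mat_vec T' (unit_col j)) ` {N..} = (\<lambda>j. mat_vec T (unit_col j)) ` {N..}"
    using assms(2) by (intro image_cong) auto
  moreover have "inj_on (\<lambda>j. mat_vec T' (unit_col j)) {N..} = inj_on (\<lambda>j. mat_vec T (unit_col j)) {N..}"
    using assms(2) by (intro inj_on_cong) auto
  ultimately show ?thesis using assms(1) by (simp add: tail_basis_def)
qed

text \<open>Let S be an inverse of T modulo finite matrices. Almost all unit vectors are fixed by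
S T, so T is injective on their span; almost all unit vectors are fixed by T S, so
they lie in the range of T, and finitely many vectors suffice to complete the columns of T
to a generating set.\<close>

lemma fredholm_tail_basis:
  fixes T :: "'k::field bmat"
  assumes "fredholm T"
  obtains N0 where "\<And>N. N0 \<le> N \<Longrightarrow> \<exists>C. tail_basis T N C"
proof -
  obtain S where "S * T - 1 \<in> Minf" "T * S - 1 \<in> Minf"
    using assms by (auto simp: fredholm_def)
  then obtain N0 M where N0: "\<And>j. N0 \<le> j \<Longrightarrow> mat_vec (S * T - 1) (unit_col j) = 0"
    and M: "\<And>j. M \<le> j \<Longrightarrow> mat_vec (T * S - 1) (unit_col j) = 0"
    unfolding Minf_iff_unit_col by blast
  have "\<exists>C. tail_basis T N C" if N: "N0 \<le> N" for N
  proof -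
    let ?t = "\<lambda>j. mat_vec T (unit_col j)"
    let ?W = "unit_col ` {N..} :: (nat \<Rightarrow>\<^sub>0 'k) set"
    have S_T: "mat_vec S (?t j) = unit_col j" if "N \<le> j" for j
      using N0[of j] N that by (simp add: mat_vec_minus mat_vec_times mat_vec_one)
    have T_S: "mat_vec T (mat_vec S (unit_col j)) = unit_col j" if "M \<le> j" for j
      using M[OF that] by (simp add: mat_vec_minus mat_vec_times mat_vec_one)
    have inj: "inj_on ?t {N..}"
      by (rule inj_onI) (metis S_T atLeast_iff unit_col_eq_iff)
    have "mat_vec S (mat_vec T y) = y" if "y \<in> col.span ?W" for y
    proof -
      have "mat_vec (S * T) y = mat_vec 1 y"
        using S_T by - (rule col.linear_eq_on_span[OF linear_mat_vec linear_mat_vec, of ?W],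
          auto simp: mat_vec_times mat_vec_one that)
      then show ?thesis by (simp add: mat_vec_times mat_vec_one)
    qed
    then have "inj_on (mat_vec T) (col.span ?W)" by (rule inj_on_inverseI)
    then have "col.independent (mat_vec T ` ?W)"
      using mat_vec.independent_injective_image independent_unit_col_image by blast
    then have indep: "col.independent (?t ` {N..})" by (simp add: image_image)
    define X where "X = ?t ` {N..} \<union> (?t ` {..<N} \<union> unit_col ` {..<M})"
    obtain B where B: "?t ` {N..} \<subseteq> B" "B \<subseteq> X" "col.independent B" "X \<subseteq> col.span B"
      by (rule col.maximal_independent_subset_extend[OF _ indep, of X]) (auto simp: X_def)
    have "?t j \<in> X" for j by (cases "N \<le> j") (auto simp: X_def)
    then have "mat_vec T ` range unit_col \<subseteq> X" by auto
    then have "col.span (mat_vec T ` range unit_col) \<subseteq> col.span X" by (rule col.span_mono)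
    then have range_T: "mat_vec T v \<in> col.span X" for v
      by (auto simp: mat_vec.span_image span_unit_col)
    have "unit_col j \<in> col.span X" for j
    proof (cases "M \<le> j")
      case True
      then show ?thesis using range_T[of "mat_vec S (unit_col j)"] T_S by simp
    next
      case False
      then show ?thesis by (intro col.span_base) (auto simp: X_def)
    qed
    then have "col.span (range unit_col) \<subseteq> col.span X"
      by (intro col.span_minimal) auto
    also have "\<dots> \<subseteq> col.span B" using B(4) by (intro col.span_minimal) auto
    finally have "col.span B = UNIV" unfolding span_unit_col by blast
    moreover have "B = ?t ` {N..} \<union> (B - ?t ` {N..})" using B(1) by blast
    moreover have "B - ?t ` {N..} \<subseteq> ?t ` {..<N} \<union> unit_col ` {..<M}" using B(2) by (auto simp: X_def)
    then have "finite (B - ?t ` {N..})" by (rule finite_subset) auto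
    ultimately have "tail_basis T N (B - ?t ` {N..})"
      unfolding tail_basis_def using inj B(3) by auto
    then show ?thesis ..
  qed
  then show ?thesis using that by blast
qed

lemma index_cong_Minf:
  assumes "fredholm T" and "T' - T \<in> Minf"
  shows "index T' = index T"
proof -
  obtain N1 where N1: "\<And>N. N1 \<le> N \<Longrightarrow> \<exists>C. tail_basis T N C"
    using fredholm_tail_basis[OF assms(1)] by blast
  obtain N2 where N2: "\<And>j. N2 \<le> j \<Longrightarrow> mat_vec (T' - T) (unit_col j) = 0"
    using assms(2) unfolding Minf_iff_unit_col by blast
  obtain C where C: "tail_basis T (max N1 N2) C" using N1[of "max N1 N2"] by auto
  have "tail_basis T' (max N1 N2) C"
    using N2 by (intro tail_basis_cong[OF C]) (simp add: mat_vec_minus)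
  then show ?thesis using C by (simp add: index_tail_basis)
qed

lemma qindex_qproj: "fredholm T \<Longrightarrow> qindex (qproj T) = index T"
  unfolding qindex_def qproj_eq_iff
  by (rule the_equality) (use Minf_zero in \<open>auto intro!: index_cong_Minf dest: spec[of _ T]\<close>)

text \<open>With N = 0 and C empty, the columns themselves form a basis.\<close>

lemma tail_basis_0_iff_bij: "tail_basis U 0 {} \<longleftrightarrow> bij (mat_vec U)"
proof -
  have img: "(\<lambda>j. mat_vec U (unit_col j)) ` {0..} = mat_vec U ` range unit_col"
    by auto
  have inj: "inj_on (\<lambda>j. mat_vec U (unit_col j)) {0..} \<longleftrightarrow> inj_on (mat_vec U) (range unit_col)"
    using comp_inj_on_iff[OF inj_unit_col[of UNIV], of "mat_vec U"] by (simp add: o_def atLeast_0)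
  have span: "col.span (mat_vec U ` range unit_col) = range (mat_vec U)"
    by (simp add: mat_vec.span_image span_unit_col)
  have "inj_on (mat_vec U) (range unit_col) \<and> col.independent (mat_vec U ` range unit_col)
      \<longleftrightarrow> inj (mat_vec U)"
    using mat_vec.inj_on_span_independent_image[of U "range unit_col"]
      mat_vec.independent_injective_image[of "range unit_col" U] independent_unit_col
      inj_on_subset[of "mat_vec U" UNIV "range unit_col"]
    unfolding span_unit_col by auto
  then show ?thesis
    unfolding tail_basis_def img inj using span by (auto simp: bij_def)
qed

lemma index_invertible:
  assumes "U * V = 1" and "V * U = 1"
  shows "index U = 0"
proof -
  have "bij (mat_vec U)"
    by (rule o_bij[of "mat_vec V"]) (simp_all add: fun_eq_iff assms mat_vec_one flip: mat_vec_times)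
  then show ?thesis
    using index_tail_basis[of U 0 "{}"] by (simp add: tail_basis_0_iff_bij)
qed

text \<open>Bijectivity alone does not suffice, because the inverse of a row- and column-finite matrix need not
be row-finite. For Fredholm matrices it is: an inverse S modulo finite matrices satisfies
U S = 1 + H with H finite, and subtracting from S the finite matrix Z with
U Z = H gives a right inverse, which is a left inverse by injectivity of U.\<close>

lemma fredholm_bij_invertible:
  fixes U :: "'k::field bmat"
  assumes "fredholm U" and bij: "bij (mat_vec U)"
  obtains V where "U * V = 1" and "V * U = 1"
proof -
  obtain S where "U * S - 1 \<in> Minf" using assms(1) by (auto simp: fredholm_def)
  then obtain N where N: "\<And>j. N \<le> j \<Longrightarrow> mat_vec (U * S - 1) (unit_col j) = 0"
    unfolding Minf_iff_unit_col by blast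
  obtain Z where Z: "\<And>j. j < N \<Longrightarrow> mat_vec Z (unit_col j) = inv_into UNIV (mat_vec U) (mat_vec (U * S - 1) (unit_col j))"
    "\<And>j. N \<le> j \<Longrightarrow> mat_vec Z (unit_col j) = mat_vec 0 (unit_col j)"
    by (rule bmat_replace_columns[of N "\<lambda>j. inv_into UNIV (mat_vec U) (mat_vec (U * S - 1) (unit_col j))" 0]) blast
  have "mat_vec 0 v = 0" for v :: "nat \<Rightarrow>\<^sub>0 'k"
    using mat_vec_minus[of 0 0 v] by simp
  then have "mat_vec (U * Z) (unit_col j) = mat_vec (U * S - 1) (unit_col j)" for j
    using Z N[of j] surj_f_inv_f[OF bij_is_surj[OF bij]] by (cases "j < N") (auto simp: mat_vec_times)
  then have "U * Z = U * S - 1" by (rule bmat_eq_unit_colI)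
  then have UV: "U * (S - Z) = 1" by (simp add: right_diff_distrib)
  have "(S - Z) * U = 1"
  proof (rule bmat_eq_unit_colI)
    fix j
    have "mat_vec U (mat_vec ((S - Z) * U) (unit_col j)) = mat_vec (U * (S - Z) * U) (unit_col j)"
      by (simp only: mat_vec_times)
    also have "\<dots> = mat_vec U (mat_vec 1 (unit_col j))"
      by (simp only: UV mult_1 mat_vec_one)
    finally show "mat_vec ((S - Z) * U) (unit_col j) = mat_vec 1 (unit_col j)"
      using bij_is_inj[OF bij] by (simp add: inj_eq)
  qed
  with UV show ?thesis by (rule that)
qed

lemma fredholm_cong_Minf:
  assumes "fredholm T" and "T' - T \<in> Minf"
  shows "fredholm T'"
proof -
  obtain S where S: "S * T - 1 \<in> Minf" "T * S - 1 \<in> Minf" using assms(1) by (auto simp: fredholm_def)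
  have "S * T' - 1 = S * (T' - T) + (S * T - 1)" "T' * S - 1 = (T' - T) * S + (T * S - 1)"
    by (simp_all add: algebra_simps)
  then show ?thesis
    unfolding fredholm_def using S assms(2) by (metis Minf_add Minf_mult_left Minf_mult_right)
qed

text \<open>If the index vanishes, the complement C of the span of the columns from number N on has
exactly N elements. Replacing the first N columns of T by these elements changes T
by a finite matrix and makes its columns a basis.\<close>

lemma fredholm_index_0_invertible:
  fixes T :: "'k::field bmat"
  assumes T: "fredholm T" and "index T = 0"
  obtains U V where "U - T \<in> Minf" "U * V = 1" "V * U = 1"
proof -
  obtain N C where C: "tail_basis T N C" using fredholm_tail_basis[OF T] by blast
  then have "card C = N" and "finite C"
    using index_tail_basis[OF C] assms(2) by (auto simp: tail_basis_def)
  then obtain f where f: "bij_betw f {..<N} C"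
    using ex_bij_betw_nat_finite[of C] by (auto simp: atLeast0LessThan)
  obtain U where U: "\<And>j. j < N \<Longrightarrow> mat_vec U (unit_col j) = f j"
    "\<And>j. N \<le> j \<Longrightarrow> mat_vec U (unit_col j) = mat_vec T (unit_col j)"
    by (rule bmat_replace_columns[of N f T]) blast
  have "mat_vec (U - T) (unit_col j) = 0" if "N \<le> j" for j
    using U(2)[OF that] by (simp add: mat_vec_minus)
  then have UT: "U - T \<in> Minf" unfolding Minf_iff_unit_col by blast
  have "tail_basis U 0 {}"
  proof -
    let ?u = "\<lambda>j. mat_vec U (unit_col j)" and ?t = "\<lambda>j. mat_vec T (unit_col j)"
    have N: "{0..} = {N..} \<union> {..<N}" by auto
    have "?u ` {N..} = ?t ` {N..}" "?u ` {..<N} = C"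
      using U f by (auto simp: bij_betw_def intro!: image_cong)
    then have img: "?u ` {0..} = ?t ` {N..} \<union> C" "?u ` {N..} \<inter> ?u ` {..<N} = {}"
      using C unfolding N image_Un tail_basis_def by auto
    have "inj_on ?u {N..}" "inj_on ?u {..<N}"
      using C f inj_on_cong[of "{N..}" ?u ?t] inj_on_cong[of "{..<N}" ?u f]
      by (simp_all add: U tail_basis_def bij_betw_def)
    then have "inj_on ?u {0..}"
      unfolding N inj_on_Un using img(2) by blast
    then show ?thesis
      unfolding tail_basis_def img(1) using C by (simp add: tail_basis_def)
  qed
  then have "bij (mat_vec U)" by (simp add: tail_basis_0_iff_bij)
  then obtain V where "U * V = 1" "V * U = 1"
    by (rule fredholm_bij_invertible[OF fredholm_cong_Minf[OF T UT]])
  with UT show ?thesis by (rule that)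
qed

section \<open>Laurent polynomials and units\<close>

text \<open>The integer power of the unit u with inverse v.\<close>

definition unit_power :: "'e::ring_1 \<Rightarrow> 'e \<Rightarrow> int \<Rightarrow> 'e" where
  "unit_power u v n = (if 0 \<le> n then u ^ nat n else v ^ nat (- n))"

lemma unit_power_add:
  assumes uv: "u * v = 1" and vu: "v * u = 1"
  shows "unit_power u v (m + n) = unit_power u v m * unit_power u v n"
proof -
  have up: "unit_power u v (n + 1) = u * unit_power u v n" for n
  proof (cases "0 \<le> n")
    case True
    then show ?thesis by (simp add: unit_power_def nat_add_distrib)
  next
    case False
    then have "nat (- n) = Suc (nat (- (n + 1)))" by simp
    with False show ?thesis
      by (auto simp: unit_power_def uv simp flip: mult.assoc)
  qed
  have down: "unit_power u v (n - 1) = v * unit_power u v n" for n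
    using up[of "n - 1"] by (simp add: vu flip: mult.assoc)
  show ?thesis
  proof (induction m rule: int_induct[of _ 0])
    case base
    show ?case by (simp add: unit_power_def)
  next
    case (step1 m)
    have "unit_power u v (m + 1 + n) = u * unit_power u v (m + n)"
      using up[of "m + n"] by (simp add: ac_simps)
    then show ?case by (simp add: step1 up mult.assoc)
  next
    case (step2 m)
    have "unit_power u v (m - 1 + n) = v * unit_power u v (m + n)"
      using down[of "m + n"] by (simp add: algebra_simps)
    then show ?case by (simp add: step2 down mult.assoc)
  qed
qed

lemma laurent_induct [case_names zero single add]:
  fixes f :: "'k::field laurent"
  assumes "P 0" and "\<And>n c. P (Poly_Mapping.single n c)" and "\<And>f g. P f \<Longrightarrow> P g \<Longrightarrow> P (f + g)"
  shows "P f"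
proof -
  have "f = (\<Sum>n\<in>Poly_Mapping.keys f. Poly_Mapping.single n (Poly_Mapping.lookup f n))"
    by (rule poly_mapping_eqI)
      (auto simp: lookup_sum lookup_single when_def in_keys_iff)
  moreover have "P (\<Sum>n\<in>A. Poly_Mapping.single n (Poly_Mapping.lookup f n))" if "finite A" for A
    using that by (induction A) (auto intro: assms)
  ultimately show ?thesis by (metis finite_keys)
qed

text \<open>Substitution of the unit u with inverse v for the indeterminate.\<close>

definition laurent_eval :: "('k::field \<Rightarrow> 'e::ring_1 \<Rightarrow> 'e) \<Rightarrow> 'e \<Rightarrow> 'e \<Rightarrow> 'k laurent \<Rightarrow> 'e" where
  "laurent_eval scaleE u v f =
     (\<Sum>n\<in>Poly_Mapping.keys f. scaleE (Poly_Mapping.lookup f n) (unit_power u v n))"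

context unital_algebra
begin

lemma laurent_eval_single:
  "laurent_eval scale u v (Poly_Mapping.single n c) = scale c (unit_power u v n)"
  by (simp add: laurent_eval_def)

lemma laurent_eval_add:
  "laurent_eval scale u v (f + g) = laurent_eval scale u v f + laurent_eval scale u v g"
  unfolding laurent_eval_def by (rule setsum_keys_plus_distrib) (simp_all add: scale_left_distrib)

lemma laurent_eval_zero: "laurent_eval scale u v 0 = 0"
  by (simp add: laurent_eval_def)

lemma laurent_eval_mult:
  assumes "u * v = 1" and "v * u = 1"
  shows "laurent_eval scale u v (f * g) = laurent_eval scale u v f * laurent_eval scale u v g"
proof (induction f rule: laurent_induct)
  case (single m c)
  show ?case
    by (induction g rule: laurent_induct)
      (simp_all add: laurent_eval_zero laurent_eval_add laurent_eval_single mult_single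
        distrib_left unit_power_add[OF assms] scale_mult_left scale_mult_right mult.commute[where 'a = 'k])
qed (simp_all add: laurent_eval_zero laurent_eval_add distrib_right)

lemma hom_laurent_eval:
  assumes "u * v = 1" and "v * u = 1"
  shows "unital_algebra_hom laurent_scale scale (laurent_eval scale u v)"
proof -
  interpret L: unital_algebra "laurent_scale :: 'k \<Rightarrow> _" by (rule unital_algebra_laurent)
  have one: "laurent_eval scale u v 1 = 1"
    using laurent_eval_single[of u v 0 1] by (simp add: unit_power_def)
  have "laurent_eval scale u v (laurent_scale c f) = scale c (laurent_eval scale u v f)" for c f
    by (simp add: laurent_scale_eq_mult laurent_eval_mult[OF assms] laurent_eval_single scale_mult_left)
      (simp add: unit_power_def)
  then have "Vector_Spaces.linear laurent_scale scale (laurent_eval scale u v)"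
    by unfold_locales (simp_all add: laurent_eval_add)
  then show ?thesis
    by (simp add: unital_algebra_hom_def one laurent_eval_mult[OF assms])
qed

end

lemma laurent_X_inverse:
  "laurent_X * Poly_Mapping.single (- 1) 1 = (1 :: 'k::field laurent)"
  "Poly_Mapping.single (- 1) 1 * laurent_X = (1 :: 'k::field laurent)"
  by (simp_all add: laurent_X_def mult_single)

lemma unit_power_laurent:
  "unit_power laurent_X (Poly_Mapping.single (- 1) 1) n = (Poly_Mapping.single n 1 :: 'k::field laurent)"
proof -
  have "(Poly_Mapping.single a 1 :: 'k laurent) ^ k = Poly_Mapping.single (int k * a) 1" for a :: int and k
    by (induction k) (simp_all add: mult_single algebra_simps)
  then show ?thesis by (simp add: unit_power_def laurent_X_def)
qed

text \<open>A homomorphism is determined on the inverse of the indeterminate, hence on all monomials, by its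
value at the indeterminate.\<close>

lemma laurent_hom_eq_id:
  assumes h: "unital_algebra_hom laurent_scale laurent_scale h" and X: "h laurent_X = laurent_X"
  shows "h f = (f :: 'k::field laurent)"
proof -
  interpret h: Vector_Spaces.linear laurent_scale laurent_scale h
    using h by (simp add: unital_algebra_hom_def)
  have mult: "h (a * b) = h a * h b" and one: "h 1 = 1" for a b
    using h by (auto simp: unital_algebra_hom_def)
  let ?Y = "Poly_Mapping.single (- 1) 1 :: 'k laurent"
  have "h ?Y = ?Y * (laurent_X * h ?Y)"
    by (simp add: laurent_X_inverse flip: mult.assoc)
  also have "\<dots> = ?Y"
    by (metis X laurent_X_inverse(1) mult mult_1_right one)
  finally have Y: "h ?Y = ?Y" .
  have power: "h (a ^ n) = h a ^ n" for a n
    by (induction n) (simp_all add: mult one)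
  have "h (unit_power laurent_X ?Y n) = unit_power laurent_X ?Y n" for n
    using X Y by (simp add: power unit_power_def)
  then have "h (Poly_Mapping.single n 1) = Poly_Mapping.single n 1" for n
    by (simp only: unit_power_laurent)
  moreover have "Poly_Mapping.single n c = laurent_scale c (Poly_Mapping.single n 1)" for n and c :: 'k
    by (simp add: laurent_scale_eq_mult mult_single)
  ultimately have "h (Poly_Mapping.single n c) = Poly_Mapping.single n c" for n c
    by (metis h.scale)
  then show ?thesis
    by (induction f rule: laurent_induct) (simp_all add: h.add)
qed

section \<open>The matrix homomorphism of an extension\<close>

context Minf_extension
begin

lemma p_mult: "p (a * b) = p a * p b" and p_one: "p 1 = 1"
  and p_linear: "Vector_Spaces.linear scaleE scaleA p"
  using p_hom by (auto simp: unital_algebra_hom_def)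

lemma p_add: "p (a + b) = p a + p b" and p_diff: "p (a - b) = p a - p b"
proof -
  interpret p: Vector_Spaces.linear scaleE scaleA p by (rule p_linear)
  show "p (a + b) = p a + p b" "p (a - b) = p a - p b" by (rule p.add p.diff)+
qed

lemma p_i: "X \<in> Minf \<Longrightarrow> p (i X) = 0"
  using exact by blast

lemma p_eq_0E:
  assumes "p a = 0"
  obtains X where "X \<in> Minf" "a = i X"
  using assms exact by blast

lemma i_mult_in_image:
  assumes "X \<in> Minf"
  obtains Y where "Y \<in> Minf" "i X * a = i Y"
  using assms p_eq_0E[of "i X * a"] by (metis p_mult p_i mult_zero_left)

lemma mult_i_in_image:
  assumes "X \<in> Minf"
  obtains Y where "Y \<in> Minf" "a * i X = i Y"
  using assms p_eq_0E[of "a * i X"] by (metis p_mult p_i mult_zero_right)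

lemma i_sum: "finite A \<Longrightarrow> (\<And>r. r \<in> A \<Longrightarrow> f r \<in> Minf) \<Longrightarrow> i (sum f A) = (\<Sum>r\<in>A. i (f r)) \<and> sum f A \<in> Minf"
proof (induction A rule: finite_induct)
  case empty
  show ?case using i_add[OF Minf_zero Minf_zero] Minf_zero by simp
next
  case (insert r A)
  then show ?case by (simp add: i_add Minf_add)
qed

end

lift_definition matrix_unit :: "nat \<Rightarrow> nat \<Rightarrow> 'k::field bmat"
  is "\<lambda>m n r s. if r = m \<and> s = n then 1 else 0"
  by (auto intro: finite_subset[of _ "{_}"])

lemma matrix_unit_in_Minf: "matrix_unit m n \<in> Minf"
  unfolding Minf_def by (auto simp: matrix_unit.rep_eq intro: finite_subset[of _ "{(m, n)}"])

lemma entry_matrix_unit_mult: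
  "entry (matrix_unit m n * A) r s = (if r = m then entry (A :: 'k::field bmat) n s else 0)"
  by (subst entry_times_superset[of "{n}"]) (auto simp: matrix_unit.rep_eq)

lemma entry_mult_matrix_unit:
  "entry (A * matrix_unit m n) r s = (if s = n then entry (A :: 'k::field bmat) r m else 0)"
proof -
  have "entry (A * matrix_unit m n) r s
      = (\<Sum>k | entry A r k \<noteq> 0. entry A r k * entry (matrix_unit m n) k s)"
    by (rule entry_times_superset) (auto simp: finite_row)
  also have "\<dots> = (\<Sum>k | entry A r k \<noteq> 0. if k = m then (if s = n then entry A r m else 0) else 0)"
    by (intro sum.cong) (auto simp: matrix_unit.rep_eq)
  also have "\<dots> = (if s = n then entry A r m else 0)"
    by (simp add: finite_row)
  finally show ?thesis .
qed

lemma bmat_eq_Minf_multI: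
  assumes "\<And>X. X \<in> Minf \<Longrightarrow> X * A = X * (B :: 'k::field bmat)"
  shows "A = B"
proof (rule bmat_eqI)
  show "entry A r s = entry B r s" for r s
    using arg_cong[OF assms[OF matrix_unit_in_Minf[of r r]], of "\<lambda>M. entry M r s"]
    by (simp add: entry_matrix_unit_mult)
qed

lemma Minf_sum_columns:
  assumes "X \<in> Minf"
  obtains N where "X = (\<Sum>r<N. X * matrix_unit r r)"
proof -
  have "finite (snd ` {(r, s). entry X r s \<noteq> 0})" using assms by (simp add: Minf_def)
  then obtain N where N: "\<forall>s \<in> snd ` {(r, s). entry X r s \<noteq> 0}. s < N"
    using finite_nat_set_iff_bounded by blast
  have entry_sum: "entry (sum f A) r s = (\<Sum>k\<in>A. entry (f k) r s)"
    if "finite A" for f :: "nat \<Rightarrow> 'a bmat" and A r s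
    using that by (induction A) (auto simp: entry_zero entry_plus)
  have "X = (\<Sum>r<N. X * matrix_unit r r)"
  proof (rule bmat_eqI)
    show "entry X r s = entry (\<Sum>r<N. X * matrix_unit r r) r s" for r s
      using N by (force simp: entry_sum entry_mult_matrix_unit)
  qed
  then show ?thesis by (rule that)
qed

context Minf_extension
begin

text \<open>The matrix that an element a of the extension is sent to is characterized by describing how
a acts by right multiplication on the ideal of finite matrices. Compatibility with the algebra
operations is immediate from this description.\<close>

definition represents :: "'e \<Rightarrow> 'k bmat \<Rightarrow> bool" where
  "represents a M \<longleftrightarrow> (\<forall>X\<in>Minf. i X * a = i (X * M))"

lemma represents_unique:
  assumes "represents a M" and "represents a M'"
  shows "M = M'"
proof (rule bmat_eq_Minf_multI)
  fix X :: "'k bmat" assume "X \<in> Minf"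
  then show "X * M = X * M'"
    using assms i_inj Minf_mult_right unfolding represents_def by (metis inj_onD)
qed

text \<open>The r-th row of the matrix is the only nonzero row of the finite matrix e a, where
e is the r-th diagonal matrix unit. Rows are thereby finite. By associativity the entries
can also be read off from the products a e, which makes the columns finite.\<close>

lemma represents_exists: "\<exists>M. represents a M"
proof -
  have "\<exists>Y\<in>Minf. i (matrix_unit r r) * a = i Y" for r
    using i_mult_in_image[OF matrix_unit_in_Minf] by metis
  then obtain Y where Y: "\<And>r. Y r \<in> Minf" "\<And>r. i (matrix_unit r r) * a = i (Y r)" by metis
  have "\<exists>Z\<in>Minf. a * i (matrix_unit s s) = i Z" for s
    using mult_i_in_image[OF matrix_unit_in_Minf] by metis
  then obtain Z where Z: "\<And>s. Z s \<in> Minf" "\<And>s. a * i (matrix_unit s s) = i (Z s)" by metis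
  have "i (Y r * matrix_unit s s) = i (matrix_unit r r * Z s)" for r s
    using Y Z by (simp add: i_mult matrix_unit_in_Minf mult.assoc flip: Y Z)
  then have YZ: "Y r * matrix_unit s s = matrix_unit r r * Z s" for r s
    using i_inj Y Z by (meson Minf_mult_left Minf_mult_right inj_onD)
  have entry_YZ: "entry (Y r) r s = entry (Z s) r s" for r s
    using arg_cong[OF YZ[of r s], of "\<lambda>M. entry M r s"]
    by (simp add: entry_matrix_unit_mult entry_mult_matrix_unit)
  have "matrix_unit r r * matrix_unit r r = (matrix_unit r r :: 'k bmat)" for r
    by (rule bmat_eqI) (simp add: entry_matrix_unit_mult matrix_unit.rep_eq)
  then have "i (matrix_unit r r * Y r) = i (Y r)" for r
    by (simp add: i_mult matrix_unit_in_Minf Y flip: Y(2) mult.assoc)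
      (simp add: matrix_unit_in_Minf flip: i_mult)
  then have Y_row: "matrix_unit r r * Y r = Y r" for r
    using i_inj Y by (meson Minf_mult_left inj_onD)
  define M where "M = Abs_bmat (\<lambda>r s. entry (Y r) r s)"
  have "finite {s. entry (Y r) r s \<noteq> 0}" and "finite {k. entry (Y k) k s \<noteq> 0}" for r s
    using finite_row[of "Y r" r] finite_col[of "Z s" s] by (simp_all add: entry_YZ)
  then have entry_M: "entry M r s = entry (Y r) r s" for r s
    unfolding M_def by (subst Abs_bmat_inverse) auto
  have M_row: "matrix_unit r r * M = Y r" for r
  proof (rule bmat_eqI)
    show "entry (matrix_unit r r * M) k s = entry (Y r) k s" for k s
      using arg_cong[OF Y_row[of r], of "\<lambda>M. entry M k s"]
      by (simp add: entry_matrix_unit_mult entry_M split: if_splits)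
  qed
  have "i X * a = i (X * M)" if X: "X \<in> Minf" for X
  proof -
    obtain N where N: "X = (\<Sum>r<N. X * matrix_unit r r)" using Minf_sum_columns[OF X] .
    have "i X = (\<Sum>r<N. i (X * matrix_unit r r))"
      using i_sum[of "{..<N}" "\<lambda>r. X * matrix_unit r r"] X N by (simp add: Minf_mult_right)
    then have "i X * a = (\<Sum>r<N. i (X * matrix_unit r r) * a)"
      by (metis sum_distrib_right)
    also have "\<dots> = (\<Sum>r<N. i (X * Y r))"
      using X by (intro sum.cong) (simp_all add: i_mult matrix_unit_in_Minf mult.assoc Y)
    also have "\<dots> = i (\<Sum>r<N. X * Y r)"
      using i_sum[of "{..<N}" "\<lambda>r. X * Y r"] X by (simp add: Minf_mult_right)
    also have "(\<Sum>r<N. X * Y r) = X * M"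
      by (subst (2) N) (simp add: sum_distrib_right mult.assoc M_row)
    finally show ?thesis .
  qed
  then show ?thesis unfolding represents_def by blast
qed

lemma represents_add: "represents a M \<Longrightarrow> represents b M' \<Longrightarrow> represents (a + b) (M + M')"
  by (simp add: represents_def distrib_left i_add Minf_mult_right)

lemma represents_scale: "represents a M \<Longrightarrow> represents (scaleE c a) (bmat_scale c M)"
  by (simp add: represents_def E.scale_mult_right Minf_mult_right
      unital_algebra.scale_mult_right[OF unital_algebra_bmat] flip: i_scale)

lemma represents_mult:
  assumes "represents a M" and "represents b M'"
  shows "represents (a * b) (M * M')"
  using assms unfolding represents_def by (metis Minf_mult_right mult.assoc)

lemma represents_one: "represents 1 1"
  by (simp add: represents_def)

lemma represents_i: "X \<in> Minf \<Longrightarrow> represents (i X) X"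
  by (simp add: represents_def i_mult)

text \<open>If \<open>\<phi>\<close> is a homomorphism that is the identity on finite matrices, then applying it to products
\<open>i X * a\<close>, which lie in the ideal, shows that \<open>\<phi> a\<close> represents a.\<close>

lemma matrix_hom_unique_existence:
  "\<exists>!\<phi>. unital_algebra_hom scaleE bmat_scale \<phi> \<and> (\<forall>X\<in>Minf. \<phi> (i X) = X)"
  and represents_hom:
  "unital_algebra_hom scaleE bmat_scale \<phi> \<Longrightarrow> \<forall>X\<in>Minf. \<phi> (i X) = X \<Longrightarrow> represents a (\<phi> a)"
proof -
  have repr: "represents a (\<phi> a)"
    if "unital_algebra_hom scaleE bmat_scale \<phi>" and id: "\<forall>X\<in>Minf. \<phi> (i X) = X" for \<phi> a
    unfolding represents_def
  proof
    have mult: "\<phi> (a * b) = \<phi> a * \<phi> b" for a b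
      using that(1) by (simp add: unital_algebra_hom_def)
    fix X :: "'k bmat" assume X: "X \<in> Minf"
    obtain Y where Y: "Y \<in> Minf" "i X * a = i Y" using i_mult_in_image[OF X] .
    then have "Y = X * \<phi> a" using mult[of "i X" a] id X by simp
    with Y show "i X * a = i (X * \<phi> a)" by simp
  qed
  then show "unital_algebra_hom scaleE bmat_scale \<phi> \<Longrightarrow> \<forall>X\<in>Minf. \<phi> (i X) = X \<Longrightarrow> represents a (\<phi> a)" .
  obtain \<phi> where \<phi>: "\<And>a. represents a (\<phi> a)"
    using represents_exists by metis
  note \<phi>_eq = represents_unique[OF \<phi>]
  interpret B: unital_algebra "bmat_scale :: 'k \<Rightarrow> _" by (rule unital_algebra_bmat)
  have hom: "unital_algebra_hom scaleE bmat_scale \<phi> \<and> (\<forall>X\<in>Minf. \<phi> (i X) = X)"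
    unfolding unital_algebra_hom_def
  proof (intro conjI allI ballI)
    show "Vector_Spaces.linear scaleE bmat_scale \<phi>"
      by unfold_locales (auto intro!: \<phi>_eq represents_add represents_scale \<phi>)
  qed (auto intro!: \<phi>_eq represents_mult represents_one represents_i \<phi>)
  show "\<exists>!\<phi>. unital_algebra_hom scaleE bmat_scale \<phi> \<and> (\<forall>X\<in>Minf. \<phi> (i X) = X)"
  proof (rule ex1I[of _ \<phi>], rule hom)
    fix \<phi>' assume \<phi>': "unital_algebra_hom scaleE bmat_scale \<phi>' \<and> (\<forall>X\<in>Minf. \<phi>' (i X) = X)"
    then have "represents a (\<phi>' a)" for a by (intro repr) auto
    then show "\<phi>' = \<phi>" by (intro ext represents_unique[OF _ \<phi>])
  qed
qed

abbreviation "\<phi> \<equiv> matrix_hom scaleE i"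

lemma hom_matrix_hom: "unital_algebra_hom scaleE bmat_scale \<phi>"
  and matrix_hom_i: "X \<in> Minf \<Longrightarrow> \<phi> (i X) = X"
  using theI'[OF matrix_hom_unique_existence] by (simp_all add: matrix_hom_def)

lemma matrix_hom_represents: "represents a (\<phi> a)"
  using represents_hom[OF hom_matrix_hom] matrix_hom_i by blast

lemma matrix_hom_mult: "\<phi> (a * b) = \<phi> a * \<phi> b" and matrix_hom_one: "\<phi> 1 = 1"
  and matrix_hom_linear: "Vector_Spaces.linear scaleE bmat_scale \<phi>"
  using hom_matrix_hom by (auto simp: unital_algebra_hom_def)

lemma matrix_hom_add: "\<phi> (a + b) = \<phi> a + \<phi> b" and matrix_hom_diff: "\<phi> (a - b) = \<phi> a - \<phi> b"
proof -
  interpret \<phi>: Vector_Spaces.linear scaleE bmat_scale \<phi> by (rule matrix_hom_linear)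
  show "\<phi> (a + b) = \<phi> a + \<phi> b" "\<phi> (a - b) = \<phi> a - \<phi> b" by (rule \<phi>.add \<phi>.diff)+
qed

lemma matrix_hom_diff_in_Minf:
  assumes "p a = p b"
  shows "\<phi> a - \<phi> b \<in> Minf"
proof -
  have "p (a - b) = 0" using assms by (simp add: p_diff)
  then obtain X where X: "X \<in> Minf" "a - b = i X" using p_eq_0E by blast
  then show ?thesis using matrix_hom_i[OF X(1)] by (simp flip: matrix_hom_diff)
qed

lemma invariant_p: "invariant scaleE i p (p a) = qproj (\<phi> a)"
proof -
  have "\<exists>!\<psi>. \<forall>a. \<psi> (p a) = qproj (\<phi> a)"
  proof
    show "\<forall>a. (qproj \<circ> \<phi> \<circ> inv_into UNIV p) (p a) = qproj (\<phi> a)"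
      using surj_f_inv_f[OF p_surj] matrix_hom_diff_in_Minf by (simp add: qproj_eq_iff)
    show "\<psi> = qproj \<circ> \<phi> \<circ> inv_into UNIV p" if "\<forall>a. \<psi> (p a) = qproj (\<phi> a)" for \<psi>
      using that surj_f_inv_f[OF p_surj] by (metis ext comp_apply)
  qed
  from theI'[OF this] show ?thesis by (simp add: invariant_def)
qed

lemma fredholm_matrix_hom:
  assumes "p a * p b = 1" and "p b * p a = 1"
  shows "fredholm (\<phi> a)"
  using assms matrix_hom_diff_in_Minf[of "b * a" 1] matrix_hom_diff_in_Minf[of "a * b" 1]
  by (auto simp: fredholm_def p_mult p_one matrix_hom_mult matrix_hom_one)

text \<open>The image of \<open>\<phi>\<close> contains all the finite matrices, hence with a matrix all its perturbations by
finite matrices.\<close>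

lemma matrix_hom_lift:
  assumes "U - \<phi> a \<in> Minf"
  obtains b where "\<phi> b = U" "p b = p a"
  using that[of "a + i (U - \<phi> a)"] assms
  by (simp add: matrix_hom_add matrix_hom_i p_add p_i)

end

text \<open>An element with matrix 0 is annihilated by the ideal of finite matrices from the left, so it
vanishes because the ideal is faithful.\<close>

lemma (in faithful_Minf_extension) inj_matrix_hom: "inj \<phi>"
proof (rule injI)
  fix a b assume "\<phi> a = \<phi> b"
  then have "represents (a - b) 0"
    using matrix_hom_represents[of "a - b"] by (simp add: matrix_hom_diff)
  then have "i X * (a - b) = i 0" if "X \<in> Minf" for X
    using that by (simp add: represents_def)
  moreover have i_0: "i 0 = 0" using i_add[OF Minf_zero Minf_zero] by simp
  ultimately have "y * (a - b) = 0" if "y \<in> i ` Minf" for y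
    using that by auto
  moreover have "0 \<in> i ` Minf" using Minf_zero i_0 by force
  ultimately have "(\<lambda>x. x * (a - b)) ` (i ` Minf) = {0}"
    by (metis (no_types, lifting) image_constant image_cong)
  then have "a - b = 0" using faithful unfolding faithful_ideal_def by blast
  then show "a = b" by simp
qed

section \<open>Trivial extensions of the Laurent polynomial algebra\<close>

theorem theorem5p9:
  fixes scaleE :: "'k::field_char_0 \<Rightarrow> 'e::ring_1 \<Rightarrow> 'e"
    and i :: "'k bmat \<Rightarrow> 'e"
    and p :: "'e \<Rightarrow> 'k laurent"
    and \<psi> :: "'k laurent \<Rightarrow> 'k qmat"
  assumes "faithful_Minf_extension scaleE laurent_scale i p"
    and "\<psi> = invariant scaleE i p"
  shows "trivial_extension scaleE laurent_scale p \<longleftrightarrow> qindex (\<psi> laurent_X) = 0"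
proof -
  interpret faithful_Minf_extension scaleE laurent_scale i p by (rule assms(1))
  let ?\<phi> = "matrix_hom scaleE i"
  let ?Y = "Poly_Mapping.single (- 1) 1 :: 'k laurent"
  have p_ex: "\<exists>a. p a = f" for f
    using p_surj by (metis surjD)
  obtain y where y: "p y = ?Y" using p_ex by blast
  have fredholm: "fredholm (?\<phi> a)" if "p a = laurent_X" for a
    by (rule fredholm_matrix_hom[of a y]) (simp_all add: that y laurent_X_inverse)
  have index_X: "qindex (\<psi> laurent_X) = index (?\<phi> a)" if "p a = laurent_X" for a
    using qindex_qproj[OF fredholm[OF that]] invariant_p[of a] that by (simp add: assms(2))
  show ?thesis
  proof
    assume "trivial_extension scaleE laurent_scale p"
    then obtain \<rho> where \<rho>: "unital_algebra_hom laurent_scale scaleE \<rho>" "p \<circ> \<rho> = id"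
      unfolding trivial_extension_def by blast
    then have "?\<phi> (\<rho> f) * ?\<phi> (\<rho> g) = ?\<phi> (\<rho> (f * g))" and one: "?\<phi> (\<rho> 1) = 1" for f g
      by (simp_all add: unital_algebra_hom_def matrix_hom_mult matrix_hom_one)
    then have "?\<phi> (\<rho> laurent_X) * ?\<phi> (\<rho> ?Y) = 1" "?\<phi> (\<rho> ?Y) * ?\<phi> (\<rho> laurent_X) = 1"
      by (simp_all add: laurent_X_inverse)
    moreover have "p (\<rho> laurent_X) = laurent_X"
      using \<rho>(2) by (metis comp_apply id_apply)
    ultimately show "qindex (\<psi> laurent_X) = 0"
      using index_X index_invertible by metis
  next
    assume index_0: "qindex (\<psi> laurent_X) = 0"
    obtain a where a: "p a = laurent_X" using p_ex by blast
    have "index (?\<phi> a) = 0" using index_X[OF a] index_0 by simp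
    then obtain U V where U: "U - ?\<phi> a \<in> Minf" and UV: "U * V = 1" "V * U = 1"
      by (rule fredholm_index_0_invertible[OF fredholm[OF a]])
    obtain u where u: "?\<phi> u = U" "p u = laurent_X"
      using matrix_hom_lift[OF U] a by metis
    \<comment> \<open>The inverse of U lies in the image of the matrix homomorphism: it agrees modulo finite
      matrices with the image of a lift of the inverse of the indeterminate.\<close>
    have "?\<phi> y * U - 1 \<in> Minf"
      using matrix_hom_diff_in_Minf[of "y * u" 1] u y
      by (simp add: p_mult p_one laurent_X_inverse matrix_hom_mult matrix_hom_one)
    then have "(?\<phi> y * U - 1) * V \<in> Minf" by (rule Minf_mult_right)
    then have "?\<phi> y - V \<in> Minf" by (simp add: left_diff_distrib mult.assoc UV)
    then have "V - ?\<phi> y \<in> Minf" using Minf_uminus by fastforce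
    then obtain v where v: "?\<phi> v = V" using matrix_hom_lift by metis
    have "?\<phi> (u * v) = ?\<phi> 1" "?\<phi> (v * u) = ?\<phi> 1"
      by (simp_all add: matrix_hom_mult matrix_hom_one u v UV)
    then have uv: "u * v = 1" "v * u = 1" using inj_matrix_hom by (auto dest: injD)
    let ?\<rho> = "laurent_eval scaleE u v"
    have \<rho>: "unital_algebra_hom laurent_scale scaleE ?\<rho>" by (rule E.hom_laurent_eval[OF uv])
    have "?\<rho> laurent_X = u"
      using E.laurent_eval_single[of u v 1 1] by (simp add: unit_power_def laurent_X_def)
    then have "(p \<circ> ?\<rho>) laurent_X = laurent_X" using u(2) by simp
    moreover have "unital_algebra_hom laurent_scale laurent_scale (p \<circ> ?\<rho>)"
      using \<rho> p_hom Vector_Spaces.linear_compose[of laurent_scale scaleE ?\<rho> laurent_scale p]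
      by (simp add: unital_algebra_hom_def)
    ultimately have "(p \<circ> ?\<rho>) f = f" for f
      using laurent_hom_eq_id by blast
    then have "p \<circ> ?\<rho> = id" by (simp add: fun_eq_iff)
    with \<rho> show "trivial_extension scaleE laurent_scale p"
      unfolding trivial_extension_def by blast
  qed
qed

end
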